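(* For each $\alpha$ with $0<\alpha<\frac1{32}$ there are constants $C>0$ and $M>0$ (depending only on $\alpha$) such that the following holds. Let $\bar u:\mathbb{R}\to\mathbb{R}$ be continuous and non-negative, with compact support $[a,b]$, positive on $(a,b)$, and with $\int_a^b\bar u(x)\,dx=1$. Let $K\ge2$, $\delta:=1/K$ and $\xi_k:=k/K$ for $k=0,\dots,K$ (equidistant mass mesh). Let $a=\bar x_0<\bar x_1<\dots<\bar x_K=b$ be determined by $$\int_{\bar x_0}^{\bar x_k}\bar u(x)\,dx=\xi_k\qquad\text{for }k=0,1,\dots,K,$$ and let $x(t)=(x_0(t),\dots,x_K(t))$, $t\ge0$, be the solution of the discretized thin film equation (defined in the context) with initial data $x_k(0)=\bar x_k$ for all $k$. If $$\bar b:=\sup_{\ell\in(a,b)}\frac{\int_{\bar x_0}^{\ell}\bar u(x)^{1+\alpha}\,dx}{\left(\int_{\bar x_0}^{\ell}\bar u(x)\,dx\right)^{1+\frac45\alpha}}<\infty,$$ then $$|x_0(t)-\bar x_0|\le M\,\delta^{\frac15}\big(\bar b^4\,t^{1+\alpha}\big)^{\frac1{5+\alpha}}\qquad\text{for all }0\le t\le C\,\bar b^{-\frac5\alpha}.$$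
   Context: Difference operators on the equidistant mesh with $\delta=1/K$: for values $f_\kappa$ indexed by half-integers $\kappa$, $\mathrm{D}_kf:=\frac{f_{k+1/2}-f_{k-1/2}}{\delta}$ for integers $k$, and $\Delta_\kappa f:=\frac{f_{\kappa+1}-2f_\kappa+f_{\kappa-1}}{\delta^2}$ for half-integers $\kappa$. Products and powers of such functions are taken pointwise. Discretized thin film equation. A solution is a differentiable curve $x(t)=(x_0(t),\dots,x_K(t))\in\mathbb{R}^{K+1}$ with $x_0(t)<x_1(t)<\dots<x_K(t)$ such that, with the densities $$z_\kappa(t):=\frac{\delta}{x_{\kappa+1/2}(t)-x_{\kappa-1/2}(t)}\quad\text{for }\kappa\in\{1/2,3/2,\dots,K-1/2\},$$ and $z_\kappa(t):=0$ for all other half-integers $\kappa$ (in particular $z_{-1/2}=z_{K+1/2}=0$ and $z_{-3/2}=z_{K+3/2}=0$), one has, for $k=0,1,\dots,K$, $$\dot x_k=\mathrm{D}_k\Big[\tfrac12 z^3\,\Delta z+\tfrac14 z^2\,\Delta(z^2)\Big].$$ *)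

theory Defs
  imports "HOL-Analysis.Analysis"
begin

text \<open>
  A family indexed by the half-integers is encoded as a function on \<^typ>\<open>int\<close>: the
  integer \<open>j\<close> stands for the half-integer \<open>j + 1/2\<close>.  Thus, for an integer \<open>k\<close>, the indices
  \<open>k + 1/2\<close> and \<open>k - 1/2\<close> become \<open>k\<close> and \<open>k - 1\<close>.
\<close>

definition diff_op :: "real \<Rightarrow> (int \<Rightarrow> real) \<Rightarrow> int \<Rightarrow> real" where
  "diff_op \<delta> f k = (f k - f (k - 1)) / \<delta>"

definition laplace_op :: "real \<Rightarrow> (int \<Rightarrow> real) \<Rightarrow> int \<Rightarrow> real" where
  "laplace_op \<delta> f j = (f (j + 1) - 2 * f j + f (j - 1)) / \<delta>\<^sup>2"

definition density :: "nat \<Rightarrow> (nat \<Rightarrow> real) \<Rightarrow> int \<Rightarrow> real" where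
  "density K x j =
     (if 0 \<le> j \<and> j < int K then (1 / real K) / (x (nat (j + 1)) - x (nat j)) else 0)"

definition thin_film_velocity :: "nat \<Rightarrow> (nat \<Rightarrow> real) \<Rightarrow> nat \<Rightarrow> real" where
  "thin_film_velocity K x k =
     (let \<delta> = 1 / real K; z = density K x in
      diff_op \<delta>
        (\<lambda>j. 1 / 2 * z j ^ 3 * laplace_op \<delta> z j
            + 1 / 4 * z j ^ 2 * laplace_op \<delta> (\<lambda>i. z i ^ 2) j)
        (int k))"

text \<open>Only the components \<open>x t k\<close> with \<open>t \<ge> 0\<close> and \<open>k \<le> K\<close> are relevant; the derivative at
  \<open>t = 0\<close> is one-sided.\<close>

definition thin_film_solution :: "nat \<Rightarrow> (real \<Rightarrow> nat \<Rightarrow> real) \<Rightarrow> bool" where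
  "thin_film_solution K x \<longleftrightarrow>
     (\<forall>t\<ge>0. (\<forall>k<K. x t k < x t (Suc k)) \<and>
       (\<forall>k\<le>K. ((\<lambda>s. x s k) has_real_derivative thin_film_velocity K (x t) k)
                 (at t within {0..})))"

definition edge_ratio :: "real \<Rightarrow> (real \<Rightarrow> real) \<Rightarrow> real \<Rightarrow> real \<Rightarrow> real" where
  "edge_ratio \<alpha> u a l =
     integral {a..l} (\<lambda>y. u y powr (1 + \<alpha>)) / integral {a..l} u powr (1 + 4 / 5 * \<alpha>)"

end

theory Submission
  imports Defs
begin

text \<open>
  In lattice units the densities satisfy \<open>z' = - K^4 z\<^sup>2 \<Delta>(flux z)\<close>. Testing with
  \<open>\<phi> z powr (\<alpha> - 1)\<close> for the cutoff \<open>\<phi> j = (max 0 (N - j))^4\<close> shows that \<open>A = \<Sum> \<phi> z powr \<alpha>\<close>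
  dissipates a multiple of \<open>\<Sum> \<phi> z powr (1 + \<alpha>) (Dz)^4\<close>, up to an error
  \<open>\<Sum> z powr (5 + \<alpha>)\<close> over the first \<open>N + 2\<close> cells. That error is
  interpolated between the dissipation at scale \<open>4 * N\<close>, with a small factor, and a power of \<open>A\<close>.
  Since the initial data give \<open>A \<le> B * N powr (5 + 4/5 \<alpha>)\<close> at every scale \<open>N\<close>, dividing by
  \<open>N powr (5 + 4/5 \<alpha>)\<close> and maximizing over \<open>N\<close> absorbs the dissipation, and the bound on \<open>A\<close>
  persists with factor \<open>2\<close> up to a time of order \<open>bbar powr (- 5/\<alpha>)\<close>. At scale \<open>N = 1\<close> this controls
  the time integral of \<open>z powr (5 + \<alpha>)\<close> in the first two cells, hence that of \<open>z^4\<close>, which bounds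
  the velocity of the left end point.
\<close>

subsection \<open>Elementary inequalities\<close>

text \<open>The exponents are dictated by scale invariance. With
  \<open>p = (5 + \<alpha>) / \<alpha>\<close>, interpolation leaves the term
  \<open>N * (A / N ^ 5) powr p\<close>. If \<open>A\<close> is of size
  \<open>B * N powr (5 + 4/5 \<alpha>)\<close>, this term is a multiple of
  \<open>B powr p * N powr (5 + 4/5 \<alpha>)\<close>, because
  \<open>4/5 * \<alpha> * p = 4 + 4/5 * \<alpha>\<close>: the same power of \<open>N\<close>
  returns, so one time span serves every scale. That span is of order
  \<open>1 / (K ^ 4 * B powr (p - 1))\<close> with \<open>p - 1 = 5 / \<alpha>\<close> and
  \<open>B = bbar * K powr (- 4/5 \<alpha>)\<close>, and all powers of \<open>K\<close> cancel. The
  obstacle is that no single scale closes: the error at \<open>N\<close> is paid for by the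
  dissipation at a larger scale, so all scales must be treated simultaneously. The cutoff is a
  fourth power because its first and second differences are then of order
  \<open>\<phi> powr (3/4)\<close> and \<open>\<phi> powr (1/2)\<close>, up to a unit shift. These
  are the weights that Young's inequality can absorb into a fourth-order dissipation, leaving only
  unweighted terms of the right degree.\<close>

lemma powr_le_bernoulli:
  fixes p \<alpha> :: real
  assumes "0 \<le> p" "0 < \<alpha>" "\<alpha> < 1"
  shows "p powr \<alpha> \<le> 1 + \<alpha> * (p - 1)"
proof (cases "p = 0")
  case False
  then show ?thesis
    using Youngs_inequality_0[of \<alpha> "1 - \<alpha>" p 1] assms by (simp add: algebra_simps)
qed (use assms in auto)

text \<open>This is the concave bound for the inverse exponent \<open>1 / (1 + \<alpha>)\<close>,
  applied to \<open>p powr (1 + \<alpha>)\<close>.\<close>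

lemma powr_ge_bernoulli:
  fixes p \<alpha> :: real
  assumes "0 \<le> p" "0 < \<alpha>"
  shows "1 + (1 + \<alpha>) * (p - 1) \<le> p powr (1 + \<alpha>)"
proof -
  have "(p powr (1 + \<alpha>)) powr (1 / (1 + \<alpha>)) \<le> 1 + 1 / (1 + \<alpha>) * (p powr (1 + \<alpha>) - 1)"
    using assms by (intro powr_le_bernoulli) auto
  then have "p \<le> 1 + 1 / (1 + \<alpha>) * (p powr (1 + \<alpha>) - 1)"
    using assms by (simp add: powr_powr)
  then have "(1 + \<alpha>) * p \<le> (1 + \<alpha>) * (1 + 1 / (1 + \<alpha>) * (p powr (1 + \<alpha>) - 1))"
    using assms by (intro mult_left_mono) auto
  also have "\<dots> = (1 + \<alpha>) + (p powr (1 + \<alpha>) - 1)"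
    using assms by (simp add: distrib_left)
  finally show ?thesis by (simp add: algebra_simps)
qed

text \<open>Taylor's formula at \<open>y\<close>, made homogeneous by \<open>u = p / y\<close>, with
  a remainder of one sign that stays bounded down to \<open>p = 0\<close>, where the upper bound on
  \<open>r\<close> is attained. Pulling out \<open>y powr (\<alpha> - 1)\<close> leaves estimates
  that are polynomial in the increments.\<close>

lemma powr_expansion:
  fixes p y \<alpha> :: real
  assumes "0 \<le> p" "0 < y" "0 < \<alpha>" "\<alpha> < 1"
  obtains r where "0 \<le> r" "r \<le> \<alpha> * (p - y)\<^sup>2"
    "p powr (1 + \<alpha>) - y powr (1 + \<alpha>) = y powr (\<alpha> - 1) * ((1 + \<alpha>) * y * (p - y) + r)"
proof -
  define u where "u = p / y"
  have u: "0 \<le> u" "p = u * y" using assms by (auto simp: u_def)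
  define r where "r = y\<^sup>2 * (u powr (1 + \<alpha>) - 1 - (1 + \<alpha>) * (u - 1))"
  have "0 \<le> r"
    unfolding r_def using powr_ge_bernoulli[OF u(1) assms(3)]
    by (intro mult_nonneg_nonneg) (auto simp: algebra_simps)
  \<comment> \<open>The concave bound for \<open>u powr \<alpha>\<close>, multiplied by
    \<open>u\<close>; subtracting the tangent line leaves exactly
    \<open>\<alpha> * (u - 1)^2\<close>.\<close>
  moreover have "u powr (1 + \<alpha>) \<le> u * (1 + \<alpha> * (u - 1))"
  proof (cases "u = 0")
    case False
    then have "u powr (1 + \<alpha>) = u * u powr \<alpha>" using u by (simp add: powr_add)
    then show ?thesis using powr_le_bernoulli[OF u(1) assms(3,4)] u(1) by (simp add: mult_left_mono)
  qed auto
  then have "r \<le> y\<^sup>2 * (u * (1 + \<alpha> * (u - 1)) - 1 - (1 + \<alpha>) * (u - 1))"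
    unfolding r_def by (intro mult_left_mono) auto
  then have "r \<le> \<alpha> * (p - y)\<^sup>2"
    unfolding u(2) by (simp add: algebra_simps power2_eq_square)
  moreover have "p powr (1 + \<alpha>) - y powr (1 + \<alpha>) = y powr (1 + \<alpha>) * (u powr (1 + \<alpha>) - 1)"
    unfolding u(2) using u(1) assms by (simp add: powr_mult algebra_simps)
  moreover have "y powr (1 + \<alpha>) = y powr (\<alpha> - 1) * y\<^sup>2"
    using assms by (simp flip: powr_numeral add: powr_add[symmetric])
  ultimately show thesis
    by (intro that[of r]) (auto simp: r_def u(2) algebra_simps power2_eq_square)
qed

text \<open>\<open>Y\<close> stands for \<open>y * (a + b)\<close>. For \<open>r = 0\<close> and
  \<open>Y = 0\<close> the product vanishes, so it cannot control \<open>a ^ 4 + b ^ 4\<close>; the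
  second summand, which is \<open>y * (a ^ 3 + b ^ 3) + a ^ 4 + b ^ 4\<close> up to the factor
  \<open>1 / 4\<close>, supplies these powers. What remains is a quadratic form in \<open>Y\<close>
  and \<open>T\<close> with mixed term \<open>Y * U\<close>. The bound on \<alpha> keeps
  \<open>U\<close> below \<open>67/100 * T\<close>, and \<open>67/100\<close> is less than the
  critical value \<open>sqrt (1/2)\<close>.\<close>

lemma principal_part_coercive:
  fixes a b Y r \<alpha> :: real
  assumes "0 < \<alpha>" "\<alpha> < 1 / 32" "0 \<le> r" "r \<le> \<alpha> * (a\<^sup>2 + b\<^sup>2)"
  shows "1 / 100 * (Y\<^sup>2 + a ^ 4 + b ^ 4)
    \<le> 1 / 4 * ((1 + \<alpha>) * Y + r) * (4 * Y + (a\<^sup>2 + b\<^sup>2))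
      + 1 / 4 * (Y * (a\<^sup>2 - a * b + b\<^sup>2) + a ^ 4 + b ^ 4)"
proof -
  define T where "T = a\<^sup>2 + b\<^sup>2"
  define U where "U = (1 + \<alpha>) / 4 * T + r + 1 / 4 * (a\<^sup>2 - a * b + b\<^sup>2)"
  have T0: "0 \<le> T" by (simp add: T_def)
  have ab: "a\<^sup>2 - a * b + b\<^sup>2 \<le> 3 / 2 * T" "0 \<le> a\<^sup>2 - a * b + b\<^sup>2"
    using zero_le_power2[of "a + b"] zero_le_power2[of "a - b"] zero_le_power2[of a] zero_le_power2[of b]
    unfolding T_def power2_sum power2_diff by (auto simp: algebra_simps)
  have aT: "\<alpha> * T \<le> 1 / 32 * T" using assms T0 by (intro mult_right_mono) auto
  have aT0: "0 \<le> \<alpha> * T" using assms T0 by auto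
  have U: "0 \<le> U" "U \<le> 67 / 100 * T"
  proof -
    define W where "W = a\<^sup>2 - a * b + b\<^sup>2"
    define V where "V = \<alpha> * T"
    have u: "U = T / 4 + V / 4 + r + W / 4" by (simp add: U_def W_def V_def field_simps)
    have w: "W \<le> 3 / 2 * T" "0 \<le> W" "r \<le> V" "0 \<le> V" "V \<le> 1 / 32 * T"
      using ab assms(4) aT aT0 by (auto simp: W_def T_def V_def)
    show "0 \<le> U" using u w assms(3) T0 by linarith
    show "U \<le> 67 / 100 * T" using u w assms(3) T0 by linarith
  qed
  have q: "T\<^sup>2 / 2 \<le> a ^ 4 + b ^ 4"
    using zero_le_power2[of "a\<^sup>2 - b\<^sup>2"] unfolding T_def power2_sum power2_diff
    by (simp add: power2_eq_square power4_eq_xxxx algebra_simps)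
  have rT: "0 \<le> r * T" using assms T0 by auto
  have Ya: "0 \<le> \<alpha> * Y\<^sup>2" using assms by auto
  have "\<bar>Y * U\<bar> \<le> \<bar>Y\<bar> * (67 / 100 * T)"
    unfolding abs_mult using U by (intro mult_left_mono) auto
  also have "\<dots> \<le> 99 / 100 * Y\<^sup>2 + 12 / 100 * T\<^sup>2"
  proof -
    \<comment> \<open>Once the claimed lower bound is set aside, \<open>99/100\<close> of
      \<open>Y\<close> squared and \<open>12/100\<close> of \<open>T\<close> squared are left; this
      suffices since \<open>4 * 0.99 * 0.12\<close> exceeds \<open>0.67 * 0.67\<close>.\<close>
    have "0 \<le> (\<bar>Y\<bar> * (99/100) - T * (67 / 200))\<^sup>2" by simp
    then have "(\<bar>Y\<bar> * T) * (6633 / 10000) \<le> Y\<^sup>2 * (9801 / 10000) + T\<^sup>2 * (4489 / 40000)"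
      by (simp add: power2_eq_square algebra_simps)
    moreover have "\<bar>Y\<bar> * (67 / 100 * T) = 67 / 100 * (\<bar>Y\<bar> * T)" by simp
    ultimately show ?thesis using zero_le_power2[of T] by linarith
  qed
  finally have "0 \<le> 99 / 100 * Y\<^sup>2 + Y * U + 12 / 100 * T\<^sup>2" by linarith
  moreover have "1 / 4 * ((1 + \<alpha>) * Y + r) * (4 * Y + T)
      + 1 / 4 * (Y * (a\<^sup>2 - a * b + b\<^sup>2) + a ^ 4 + b ^ 4)
     = (1 + \<alpha>) * Y\<^sup>2 + Y * U + r * T / 4 + 1 / 4 * (a ^ 4 + b ^ 4)"
    unfolding U_def by (simp add: power2_eq_square field_simps)
  ultimately show ?thesis using q rT Ya unfolding T_def[symmetric]
    by (simp add: algebra_simps)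
qed

lemma young_cubic:
  fixes s w \<eta> :: real
  assumes "0 \<le> s" "0 \<le> w" "0 < \<eta>"
  shows "s ^ 3 * w \<le> \<eta> * s ^ 4 + w ^ 4 / \<eta> ^ 3"
proof (cases "w \<le> \<eta> * s")
  case True
  then have "s ^ 3 * w \<le> s ^ 3 * (\<eta> * s)" using assms by (intro mult_left_mono) auto
  moreover have "0 \<le> w ^ 4 / \<eta> ^ 3" using assms by auto
  ultimately show ?thesis by (simp add: power4_eq_xxxx power3_eq_cube algebra_simps)
next
  case False
  then have "s \<le> w / \<eta>" using assms by (simp add: field_simps)
  then have "s ^ 3 * w \<le> (w / \<eta>) ^ 3 * w" using assms by (intro mult_right_mono power_mono) auto
  moreover have "0 \<le> \<eta> * s ^ 4" using assms by auto
  ultimately show ?thesis by (simp add: power4_eq_xxxx power3_eq_cube field_simps)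
qed

lemma young_square:
  fixes s w \<eta> :: real
  assumes "0 < \<eta>"
  shows "s\<^sup>2 * w\<^sup>2 \<le> \<eta> * s ^ 4 + w ^ 4 / \<eta>"
proof -
  have "0 \<le> (\<eta> * s\<^sup>2 - w\<^sup>2)\<^sup>2" by simp
  then have "2 * \<eta> * (s\<^sup>2 * w\<^sup>2) \<le> \<eta>\<^sup>2 * s ^ 4 + w ^ 4"
    by (simp add: power2_eq_square power4_eq_xxxx algebra_simps)
  then have "2 * (s\<^sup>2 * w\<^sup>2) \<le> \<eta> * s ^ 4 + w ^ 4 / \<eta>"
    using assms by (simp add: field_simps power2_eq_square)
  moreover have "0 \<le> s\<^sup>2 * w\<^sup>2" by simp
  ultimately show ?thesis by linarith
qed

lemma power4_add_le:
  fixes x y :: real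
  shows "(x + y) ^ 4 \<le> 8 * x ^ 4 + 8 * y ^ 4"
proof -
  have "(x + y) ^ 4 = ((x + y)\<^sup>2)\<^sup>2" by simp
  also have "\<dots> \<le> (2 * x\<^sup>2 + 2 * y\<^sup>2)\<^sup>2"
  proof (rule power_mono)
    have "0 \<le> (x - y)\<^sup>2" by simp
    then show "(x + y)\<^sup>2 \<le> 2 * x\<^sup>2 + 2 * y\<^sup>2" by (simp add: power2_sum power2_diff)
  qed auto
  also have "\<dots> \<le> 8 * x ^ 4 + 8 * y ^ 4"
  proof -
    have "0 \<le> (x\<^sup>2 - y\<^sup>2)\<^sup>2" by simp
    then show ?thesis by (simp add: power2_eq_square power4_eq_xxxx algebra_simps)
  qed
  finally show ?thesis .
qed

text \<open>In terms of \<open>s = (\<psi> + 1) * x\<close> the left side consists of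
  \<open>s ^ 3 * y\<close>, \<open>s ^ 3 * x\<close> and \<open>s^2 * y^2\<close>: each loss of
  weight comes with an unweighted factor, so Young's inequality leaves a small multiple of
  \<open>s ^ 4\<close>. Replacing \<open>\<psi> + 1\<close> by \<open>\<psi>\<close> costs an
  unweighted \<open>x ^ 4\<close>.\<close>

lemma weight_error_absorption:
  fixes \<eta> :: real
  assumes "0 < \<eta>"
  obtains C where "0 \<le> C" and
    "\<And>\<psi> y x :: real. 0 \<le> \<psi> \<Longrightarrow> 0 \<le> y \<Longrightarrow> 0 \<le> x \<Longrightarrow>
      17 * (\<psi> + 1) ^ 3 * (y * x ^ 3 + x ^ 4) + 12 * (\<psi> + 1)\<^sup>2 * y\<^sup>2 * x\<^sup>2
        \<le> \<eta> * \<psi> ^ 4 * x ^ 4 + C * (y ^ 4 + x ^ 4)"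
proof -
  \<comment> \<open>\<open>368 = 46 * 8\<close>: Young produces \<open>17 + 17 + 12\<close> copies
    of \<open>e * s ^ 4\<close>, and \<open>power4_add_le\<close> contributes the factor
    \<open>8\<close>.\<close>
  define e where "e = \<eta> / 368"
  have e: "0 < e" using assms by (simp add: e_def)
  define C where "C = 17 / e ^ 3 + 12 / e + \<eta>"
  have "17 * (\<psi> + 1) ^ 3 * (y * x ^ 3 + x ^ 4) + 12 * (\<psi> + 1)\<^sup>2 * y\<^sup>2 * x\<^sup>2
        \<le> \<eta> * \<psi> ^ 4 * x ^ 4 + C * (y ^ 4 + x ^ 4)"
    if h: "0 \<le> \<psi>" "0 \<le> y" "0 \<le> x" for \<psi> y x :: real
  proof -
    define s where "s = (\<psi> + 1) * x"
    have s: "0 \<le> s" using h by (simp add: s_def)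
    have "(\<psi> + 1) ^ 4 \<le> 8 * \<psi> ^ 4 + 8" using power4_add_le[of \<psi> 1] by simp
    then have "(\<psi> + 1) ^ 4 * x ^ 4 \<le> (8 * \<psi> ^ 4 + 8) * x ^ 4"
      using h by (intro mult_right_mono) auto
    then have s4: "s ^ 4 \<le> 8 * \<psi> ^ 4 * x ^ 4 + 8 * x ^ 4"
      unfolding s_def power_mult_distrib by (simp add: distrib_right)
    have "17 * (\<psi> + 1) ^ 3 * (y * x ^ 3 + x ^ 4) + 12 * (\<psi> + 1)\<^sup>2 * y\<^sup>2 * x\<^sup>2
        = 17 * (s ^ 3 * y) + 17 * (s ^ 3 * x) + 12 * (s\<^sup>2 * y\<^sup>2)"
      unfolding s_def power_mult_distrib by (simp add: power4_eq_xxxx power3_eq_cube algebra_simps)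
    also have "\<dots> \<le> 17 * (e * s ^ 4 + y ^ 4 / e ^ 3) + 17 * (e * s ^ 4 + x ^ 4 / e ^ 3)
        + 12 * (e * s ^ 4 + y ^ 4 / e)"
      by (intro add_mono mult_left_mono young_cubic young_square s h e) auto
    also have "\<dots> = 46 * e * s ^ 4 + (17 / e ^ 3 + 12 / e) * y ^ 4 + 17 / e ^ 3 * x ^ 4"
      by (simp add: algebra_simps)
    also have "46 * e * s ^ 4 \<le> 46 * e * (8 * \<psi> ^ 4 * x ^ 4 + 8 * x ^ 4)"
      using s4 e by (intro mult_left_mono) auto
    also have "\<dots> = \<eta> * \<psi> ^ 4 * x ^ 4 + \<eta> * x ^ 4" by (simp add: e_def algebra_simps)
    finally have *: "17 * (\<psi> + 1) ^ 3 * (y * x ^ 3 + x ^ 4) + 12 * (\<psi> + 1)\<^sup>2 * y\<^sup>2 * x\<^sup>2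
      \<le> \<eta> * \<psi> ^ 4 * x ^ 4 + \<eta> * x ^ 4 + (17 / e ^ 3 + 12 / e) * y ^ 4 + 17 / e ^ 3 * x ^ 4" by simp
    have "0 \<le> \<eta> * y ^ 4" "0 \<le> 12 / e * x ^ 4" using assms e h by auto
    then show ?thesis using * unfolding C_def by (simp add: algebra_simps)
  qed
  moreover have "0 \<le> C" using e assms by (simp add: C_def)
  ultimately show thesis using that by blast
qed

text \<open>\<open>\<psi>\<close> is the distance \<open>N - j\<close>, cut off at zero.
  \<open>g\<close> and \<open>h\<close> are the differences of the cutoff to the right and to the
  left neighbour, \<open>h - g\<close> is its second difference. The bounds involve
  \<open>\<psi> + 1\<close> because \<open>h = 1\<close> at \<open>\<psi> = 0\<close>, where the
  cutoff itself vanishes.\<close>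

lemma cutoff_increment_bounds:
  fixes \<psi> :: real
  assumes "\<psi> = 0 \<or> 1 \<le> \<psi>"
  defines "g \<equiv> \<psi> ^ 4 - (max 0 (\<psi> - 1)) ^ 4" and "h \<equiv> (\<psi> + 1) ^ 4 - \<psi> ^ 4"
  shows "0 \<le> g" "g \<le> 4 * (\<psi> + 1) ^ 3" "0 \<le> h" "h \<le> 4 * (\<psi> + 1) ^ 3"
    "0 \<le> h - g" "h - g \<le> 12 * (\<psi> + 1)\<^sup>2"
proof -
  have e: "0 \<le> g \<and> g \<le> 4 * (\<psi> + 1) ^ 3 \<and> 0 \<le> h \<and> h \<le> 4 * (\<psi> + 1) ^ 3 \<and>
    0 \<le> h - g \<and> h - g \<le> 12 * (\<psi> + 1)\<^sup>2"
  proof (cases "\<psi> = 0")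
    case True
    then show ?thesis by (simp add: g_def h_def)
  next
    case False
    with assms have p: "1 \<le> \<psi>" by simp
    then have m: "max 0 (\<psi> - 1) = \<psi> - 1" by simp
    define u where "u = \<psi> - 1"
    have u: "\<psi> = u + 1" "0 \<le> u" using p by (auto simp: u_def)
    have n: "0 \<le> u * u" "0 \<le> u * (u * u)" using u(2) by auto
    have g: "g = 1 + 4 * u + 6 * (u * u) + 4 * (u * (u * u))"
      unfolding g_def m unfolding u(1) by (simp add: power4_eq_xxxx algebra_simps)
    have h: "h = 15 + 28 * u + 18 * (u * u) + 4 * (u * (u * u))"
      unfolding h_def unfolding u(1) by (simp add: power4_eq_xxxx algebra_simps)
    have 3: "(\<psi> + 1) ^ 3 = 8 + 12 * u + 6 * (u * u) + u * (u * u)"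
      unfolding u(1) by (simp add: power3_eq_cube algebra_simps)
    have 2: "(\<psi> + 1)\<^sup>2 = 4 + 4 * u + u * u"
      unfolding u(1) by (simp add: power2_eq_square algebra_simps)
    show ?thesis unfolding g h 2 3 using u(2) n by auto
  qed
  then show "0 \<le> g" "g \<le> 4 * (\<psi> + 1) ^ 3" "0 \<le> h" "h \<le> 4 * (\<psi> + 1) ^ 3"
    "0 \<le> h - g" "h - g \<le> 12 * (\<psi> + 1)\<^sup>2" by auto
qed

text \<open>The scale \<open>x\<close> bounds both increments, \<open>4 * x^2\<close> bounds the
  flux factor, and \<open>x ^ 4\<close> is comparable to what the principal part controls. In
  \<open>17\<close>, the two first differences contribute \<open>16\<close> and the edge term
  contributes \<open>1\<close>; the second difference gives the \<open>12\<close>.\<close>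

lemma weight_error_bound:
  fixes a b y x Y ra rb g h k \<psi> \<alpha> :: real
  assumes \<alpha>: "0 < \<alpha>" "\<alpha> < 1 / 32" and "0 \<le> \<psi>" "0 \<le> y" "0 \<le> x"
    and r: "0 \<le> ra" "ra \<le> \<alpha> * a\<^sup>2" "0 \<le> rb" "rb \<le> \<alpha> * b\<^sup>2"
    and x: "\<bar>Y\<bar> + (a\<^sup>2 + b\<^sup>2) = x\<^sup>2"
    and g: "0 \<le> g" "g \<le> 4 * (\<psi> + 1) ^ 3" and h: "0 \<le> h" "h \<le> 4 * (\<psi> + 1) ^ 3"
    and k: "0 \<le> k" "k \<le> 12 * (\<psi> + 1)\<^sup>2"
  shows "\<bar>(- g * ((1 + \<alpha>) * y * a + ra) + h * ((1 + \<alpha>) * y * b + rb) + k * y\<^sup>2)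
        * (4 * Y + (a\<^sup>2 + b\<^sup>2)) / 4 + 1 / 4 * (h * b ^ 3 * (y + b))\<bar>
    \<le> 17 * (\<psi> + 1) ^ 3 * (y * x ^ 3 + x ^ 4) + 12 * (\<psi> + 1)\<^sup>2 * y\<^sup>2 * x\<^sup>2"
proof -
  have a2: "a\<^sup>2 \<le> x\<^sup>2" and b2: "b\<^sup>2 \<le> x\<^sup>2"
    using x zero_le_power2[of a] zero_le_power2[of b] abs_ge_zero[of Y] by linarith+
  then have ax: "\<bar>a\<bar> \<le> x" and bx: "\<bar>b\<bar> \<le> x"
    using \<open>0 \<le> x\<close> power2_le_imp_le[of "\<bar>a\<bar>" x] power2_le_imp_le[of "\<bar>b\<bar>" x] by auto
  define P where "P = 2 * y * x + 2 * x\<^sup>2"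
  have P: "0 \<le> P" using assms by (simp add: P_def)
  have *: "\<bar>(1 + \<alpha>) * y * c + rc\<bar> \<le> P"
    if c: "\<bar>c\<bar> \<le> x" "0 \<le> rc" "rc \<le> \<alpha> * c\<^sup>2" "c\<^sup>2 \<le> x\<^sup>2" for c rc
  proof -
    have "\<bar>(1 + \<alpha>) * y * c\<bar> \<le> 2 * y * x"
      unfolding abs_mult using \<alpha> \<open>0 \<le> y\<close> c \<open>0 \<le> x\<close> by (intro mult_mono) auto
    moreover have "\<alpha> * c\<^sup>2 \<le> 2 * x\<^sup>2" using \<alpha> c by (intro mult_mono) auto
    ultimately show ?thesis using c unfolding P_def by linarith
  qed
  have "\<bar>- g * ((1 + \<alpha>) * y * a + ra)\<bar> \<le> 4 * (\<psi> + 1) ^ 3 * P"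
    unfolding abs_mult abs_minus using \<open>0 \<le> \<psi>\<close> g *[OF ax r(1,2) a2] by (intro mult_mono) auto
  moreover have "\<bar>h * ((1 + \<alpha>) * y * b + rb)\<bar> \<le> 4 * (\<psi> + 1) ^ 3 * P"
    unfolding abs_mult using \<open>0 \<le> \<psi>\<close> h *[OF bx r(3,4) b2] by (intro mult_mono) auto
  moreover have "\<bar>k * y\<^sup>2\<bar> \<le> 12 * (\<psi> + 1)\<^sup>2 * y\<^sup>2"
    unfolding abs_mult using k by (intro mult_mono) auto
  ultimately have 1: "\<bar>- g * ((1 + \<alpha>) * y * a + ra) + h * ((1 + \<alpha>) * y * b + rb) + k * y\<^sup>2\<bar>
    \<le> 8 * (\<psi> + 1) ^ 3 * P + 12 * (\<psi> + 1)\<^sup>2 * y\<^sup>2" by linarith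
  have 2: "\<bar>4 * Y + (a\<^sup>2 + b\<^sup>2)\<bar> \<le> 4 * x\<^sup>2"
    using x zero_le_power2[of a] zero_le_power2[of b] by linarith
  have 3: "\<bar>(- g * ((1 + \<alpha>) * y * a + ra) + h * ((1 + \<alpha>) * y * b + rb) + k * y\<^sup>2)
        * (4 * Y + (a\<^sup>2 + b\<^sup>2))\<bar> \<le> (8 * (\<psi> + 1) ^ 3 * P + 12 * (\<psi> + 1)\<^sup>2 * y\<^sup>2) * (4 * x\<^sup>2)"
    unfolding abs_mult[of "_ + k * y\<^sup>2"] using 1 2 by (intro mult_mono) auto
  have 4: "\<bar>h * b ^ 3 * (y + b)\<bar> \<le> (4 * (\<psi> + 1) ^ 3) * x ^ 3 * (y + x)"
    unfolding abs_mult power_abs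
    using h bx \<open>0 \<le> y\<close> \<open>0 \<le> x\<close> \<open>0 \<le> \<psi>\<close> by (intro mult_mono power_mono) auto
  have "\<bar>(- g * ((1 + \<alpha>) * y * a + ra) + h * ((1 + \<alpha>) * y * b + rb) + k * y\<^sup>2)
        * (4 * Y + (a\<^sup>2 + b\<^sup>2)) / 4 + 1 / 4 * (h * b ^ 3 * (y + b))\<bar>
    \<le> (8 * (\<psi> + 1) ^ 3 * P + 12 * (\<psi> + 1)\<^sup>2 * y\<^sup>2) * (4 * x\<^sup>2) / 4
      + 1 / 4 * ((4 * (\<psi> + 1) ^ 3) * x ^ 3 * (y + x))"
    using 3 4 by linarith
  also have "\<dots> = 17 * (\<psi> + 1) ^ 3 * (y * x ^ 3 + x ^ 4) + 12 * (\<psi> + 1)\<^sup>2 * y\<^sup>2 * x\<^sup>2"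
    unfolding P_def by (simp add: power4_eq_xxxx power3_eq_cube power2_eq_square algebra_simps)
  finally show ?thesis .
qed

text \<open>With \<open>y\<close>, \<open>p\<close>, \<open>q\<close> the density at a vertex and at its right and left neighbour, the terms
  with factor \<open>1 / 4\<close> sum to something nonpositive over all vertices (lemma \<open>edge_sum_nonpos\<close>);
  only after adding them is the flux term coercive vertex by vertex.\<close>

lemma vertex_dissipation:
  fixes \<alpha> :: real
  assumes \<alpha>: "0 < \<alpha>" "\<alpha> < 1 / 32"
  obtains C where "0 \<le> C" and
    "\<And>y p q \<psi> :: real. 0 \<le> y \<Longrightarrow> 0 \<le> p \<Longrightarrow> 0 \<le> q \<Longrightarrow> \<psi> = 0 \<or> 1 \<le> \<psi> \<Longrightarrow>
      1 / 200 * \<psi> ^ 4 * y powr (1 + \<alpha>) * ((p - y) ^ 4 + (q - y) ^ 4)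
        - C * y powr (1 + \<alpha>) * (y ^ 4 + (p - y) ^ 4 + (q - y) ^ 4)
      \<le> ((max 0 (\<psi> - 1)) ^ 4 * p powr (1 + \<alpha>) - 2 * (\<psi> ^ 4 * y powr (1 + \<alpha>))
            + (\<psi> + 1) ^ 4 * q powr (1 + \<alpha>))
          * (y\<^sup>2 / 4 * (4 * y * (p - 2 * y + q) + (p - y)\<^sup>2 + (q - y)\<^sup>2))
        + 1 / 4 * (\<psi> ^ 4 * (y powr (2 + \<alpha>) * ((p - y) ^ 3 + (q - y) ^ 3)
                + y powr (1 + \<alpha>) * ((p - y) ^ 4 + (q - y) ^ 4))
            + ((\<psi> + 1) ^ 4 - \<psi> ^ 4) * y powr (1 + \<alpha>) * (q - y) ^ 3 * q)"
proof -
  \<comment> \<open>Since \<open>x ^ 4\<close> is at most \<open>2 * Y^2 + 4 * Q\<close>, the choice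
    \<open>1 / 800\<close> lets the weight errors consume at most \<open>1 / 200\<close> of the
    \<open>1 / 100\<close> gained from the principal part.\<close>
  obtain C where C: "0 \<le> C" and
    abs: "\<And>\<psi> y x :: real. 0 \<le> \<psi> \<Longrightarrow> 0 \<le> y \<Longrightarrow> 0 \<le> x \<Longrightarrow>
      17 * (\<psi> + 1) ^ 3 * (y * x ^ 3 + x ^ 4) + 12 * (\<psi> + 1)\<^sup>2 * y\<^sup>2 * x\<^sup>2
        \<le> 1 / 800 * \<psi> ^ 4 * x ^ 4 + C * (y ^ 4 + x ^ 4)"
    using weight_error_absorption[of "1 / 800"] by auto
  show thesis
  proof (rule that[of "8 * C"])
    fix y p q \<psi> :: real
    assume h: "0 \<le> y" "0 \<le> p" "0 \<le> q" "\<psi> = 0 \<or> 1 \<le> \<psi>"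
    define a where "a = p - y"
    define b where "b = q - y"
    define Q where "Q = a ^ 4 + b ^ 4"
    define g where "g = \<psi> ^ 4 - (max 0 (\<psi> - 1)) ^ 4"
    define k where "k = (\<psi> + 1) ^ 4 - \<psi> ^ 4"
    define Y where "Y = y * (a + b)"
    define T where "T = a\<^sup>2 + b\<^sup>2"
    have \<psi>0: "0 \<le> \<psi>" using h by auto
    show "1 / 200 * \<psi> ^ 4 * y powr (1 + \<alpha>) * ((p - y) ^ 4 + (q - y) ^ 4)
        - 8 * C * y powr (1 + \<alpha>) * (y ^ 4 + (p - y) ^ 4 + (q - y) ^ 4)
      \<le> ((max 0 (\<psi> - 1)) ^ 4 * p powr (1 + \<alpha>) - 2 * (\<psi> ^ 4 * y powr (1 + \<alpha>))
            + (\<psi> + 1) ^ 4 * q powr (1 + \<alpha>))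
          * (y\<^sup>2 / 4 * (4 * y * (p - 2 * y + q) + (p - y)\<^sup>2 + (q - y)\<^sup>2))
        + 1 / 4 * (\<psi> ^ 4 * (y powr (2 + \<alpha>) * ((p - y) ^ 3 + (q - y) ^ 3)
                + y powr (1 + \<alpha>) * ((p - y) ^ 4 + (q - y) ^ 4))
            + ((\<psi> + 1) ^ 4 - \<psi> ^ 4) * y powr (1 + \<alpha>) * (q - y) ^ 3 * q)"
    proof (cases "y = 0")
      case False
      with h have y: "0 < y" by simp
      have \<alpha>1: "\<alpha> < 1" using \<alpha> by simp
      obtain ra where ra: "0 \<le> ra" "ra \<le> \<alpha> * a\<^sup>2"
        "p powr (1 + \<alpha>) - y powr (1 + \<alpha>) = y powr (\<alpha> - 1) * ((1 + \<alpha>) * y * a + ra)"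
        using powr_expansion[OF h(2) y \<alpha>(1) \<alpha>1] unfolding a_def by blast
      obtain rb where rb: "0 \<le> rb" "rb \<le> \<alpha> * b\<^sup>2"
        "q powr (1 + \<alpha>) - y powr (1 + \<alpha>) = y powr (\<alpha> - 1) * ((1 + \<alpha>) * y * b + rb)"
        using powr_expansion[OF h(3) y \<alpha>(1) \<alpha>1] unfolding b_def by blast
      define m where "m = y powr (\<alpha> - 1)"
      have m: "0 \<le> m" by (simp add: m_def)
      have y1: "y powr (1 + \<alpha>) = m * y\<^sup>2" and y2: "y powr (2 + \<alpha>) = m * y\<^sup>2 * y"
        using y powr_add[of y "\<alpha> - 1" 2] powr_add[of y "\<alpha> - 1" 3]
        by (auto simp: m_def power2_eq_square power3_eq_cube)
      define x where "x = sqrt (\<bar>Y\<bar> + T)"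
      have T0: "0 \<le> T" by (simp add: T_def)
      have x: "0 \<le> x" "\<bar>Y\<bar> + (a\<^sup>2 + b\<^sup>2) = x\<^sup>2" using T0 by (auto simp: x_def T_def)
      have x4: "x ^ 4 = (\<bar>Y\<bar> + T)\<^sup>2" using x T_def by simp
      have T2: "T\<^sup>2 \<le> 2 * Q"
        using zero_le_power2[of "a\<^sup>2 - b\<^sup>2"] unfolding T_def Q_def
        by (simp add: power2_eq_square power4_eq_xxxx algebra_simps)
      have Q0: "0 \<le> Q" by (simp add: Q_def)
      have x4a: "x ^ 4 \<le> 2 * Y\<^sup>2 + 4 * Q"
        unfolding x4 using zero_le_power2[of "\<bar>Y\<bar> - T"] T2 by (simp add: power2_sum power2_diff)
      have Y2: "Y\<^sup>2 \<le> y ^ 4 + 2 * Q"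
      proof -
        have "Y\<^sup>2 \<le> y\<^sup>2 * (2 * T)"
          unfolding Y_def T_def power_mult_distrib
          using zero_le_power2[of "a - b"] by (intro mult_left_mono) (auto simp: power2_sum power2_diff)
        also have "\<dots> \<le> y ^ 4 + T\<^sup>2"
          using zero_le_power2[of "y\<^sup>2 - T"] by (simp add: power2_eq_square power4_eq_xxxx algebra_simps)
        finally show ?thesis using T2 by linarith
      qed
      \<comment> \<open>The neighbours' weights are written as \<open>\<psi> ^ 4 - g\<close> and
        \<open>\<psi> ^ 4 + k\<close>. \<open>M\<close> collects everything with the common weight
        \<open>\<psi> ^ 4\<close>, and \<open>E\<close> the rest; the common factor
        \<open>m * y^2\<close> is removed from both.\<close>
      define M where "M = 1 / 4 * ((1 + \<alpha>) * Y + (ra + rb)) * (4 * Y + (a\<^sup>2 + b\<^sup>2))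
        + 1 / 4 * (Y * (a\<^sup>2 - a * b + b\<^sup>2) + a ^ 4 + b ^ 4)"
      define E where "E = (- g * ((1 + \<alpha>) * y * a + ra) + k * ((1 + \<alpha>) * y * b + rb) + (k - g) * y\<^sup>2)
        * (4 * Y + (a\<^sup>2 + b\<^sup>2)) / 4 + 1 / 4 * (k * b ^ 3 * (y + b))"
      have "1 / 100 * (Y\<^sup>2 + a ^ 4 + b ^ 4) \<le> M"
        unfolding M_def using ra rb \<alpha> by (intro principal_part_coercive) (auto simp: algebra_simps)
      then have M: "\<psi> ^ 4 * (1 / 100 * (Y\<^sup>2 + Q)) \<le> \<psi> ^ 4 * M"
        unfolding Q_def using \<psi>0 by (intro mult_left_mono) (auto simp: algebra_simps)
      note cb = cutoff_increment_bounds[OF h(4)]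
      have "\<bar>E\<bar> \<le> 17 * (\<psi> + 1) ^ 3 * (y * x ^ 3 + x ^ 4) + 12 * (\<psi> + 1)\<^sup>2 * y\<^sup>2 * x\<^sup>2"
        unfolding E_def g_def k_def
        by (rule weight_error_bound[OF \<alpha> \<psi>0 h(1) x(1) ra(1,2) rb(1,2) x(2) cb])
      also have "\<dots> \<le> 1 / 800 * \<psi> ^ 4 * x ^ 4 + C * (y ^ 4 + x ^ 4)"
        by (rule abs[OF \<psi>0 h(1) x(1)])
      also have "\<dots> \<le> 1 / 800 * \<psi> ^ 4 * (2 * Y\<^sup>2 + 4 * Q) + C * (8 * (y ^ 4 + Q))"
      proof -
        have "0 \<le> y ^ 4" by simp
        then have "y ^ 4 + x ^ 4 \<le> 8 * (y ^ 4 + Q)" using x4a Y2 Q0 by argo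
        then show ?thesis using x4a C \<psi>0 by (intro add_mono mult_left_mono) auto
      qed
      also have "\<dots> \<le> \<psi> ^ 4 * (1 / 200 * (Y\<^sup>2 + Q)) + 8 * C * (y ^ 4 + Q)"
      proof -
        have "0 \<le> \<psi> ^ 4 * Y\<^sup>2" using \<psi>0 by simp
        then show ?thesis by (simp add: algebra_simps)
      qed
      finally have E: "\<bar>E\<bar> \<le> \<psi> ^ 4 * (1 / 200 * (Y\<^sup>2 + Q)) + 8 * C * (y ^ 4 + Q)" .
      define R where "R = \<psi> ^ 4 * Y\<^sup>2"
      define S where "S = \<psi> ^ 4 * Q"
      have "0 \<le> R" using \<psi>0 by (simp add: R_def)
      moreover have "R / 100 + S / 100 \<le> \<psi> ^ 4 * M"
        using M by (simp add: R_def S_def algebra_simps)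
      moreover have "\<bar>E\<bar> \<le> R / 200 + S / 200 + 8 * C * (y ^ 4 + Q)"
        using E by (simp add: R_def S_def algebra_simps add_divide_distrib)
      ultimately have "1 / 200 * S - 8 * C * (y ^ 4 + Q) \<le> \<psi> ^ 4 * M + E"
        by linarith
      then have "1 / 200 * \<psi> ^ 4 * Q - 8 * C * (y ^ 4 + Q) \<le> \<psi> ^ 4 * M + E"
        by (simp add: S_def)
      then have "m * y\<^sup>2 * (1 / 200 * \<psi> ^ 4 * Q - 8 * C * (y ^ 4 + Q)) \<le> m * y\<^sup>2 * (\<psi> ^ 4 * M + E)"
        using m by (intro mult_left_mono) auto
      also have "m * y\<^sup>2 * (\<psi> ^ 4 * M + E) = 
        ((\<psi> ^ 4 - g) * (m * y\<^sup>2 + m * ((1 + \<alpha>) * y * a + ra)) - 2 * (\<psi> ^ 4 * (m * y\<^sup>2))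
            + (\<psi> ^ 4 + k) * (m * y\<^sup>2 + m * ((1 + \<alpha>) * y * b + rb)))
          * (y\<^sup>2 / 4 * (4 * y * (a + b) + a\<^sup>2 + b\<^sup>2))
        + 1 / 4 * (\<psi> ^ 4 * (m * y\<^sup>2 * y * (a ^ 3 + b ^ 3) + m * y\<^sup>2 * (a ^ 4 + b ^ 4))
            + k * (m * y\<^sup>2) * b ^ 3 * (y + b))"
      proof -
        have "(\<psi> ^ 4 - g) * (m * y\<^sup>2 + m * ((1 + \<alpha>) * y * a + ra)) - 2 * (\<psi> ^ 4 * (m * y\<^sup>2))
            + (\<psi> ^ 4 + k) * (m * y\<^sup>2 + m * ((1 + \<alpha>) * y * b + rb))
          = m * (\<psi> ^ 4 * ((1 + \<alpha>) * Y + (ra + rb))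
              + (- g * ((1 + \<alpha>) * y * a + ra) + k * ((1 + \<alpha>) * y * b + rb) + (k - g) * y\<^sup>2))"
          unfolding Y_def by (simp add: algebra_simps)
        note e1 = this
        have e2: "4 * y * (a + b) + a\<^sup>2 + b\<^sup>2 = 4 * Y + (a\<^sup>2 + b\<^sup>2)"
          unfolding Y_def by simp
        have e3: "m * y\<^sup>2 * y * (a ^ 3 + b ^ 3) = m * y\<^sup>2 * (Y * (a\<^sup>2 - a * b + b\<^sup>2))"
          unfolding Y_def by (simp add: algebra_simps power2_eq_square power3_eq_cube)
        have e4: "v * (\<phi> * (1 / 4 * P * L + 1 / 4 * (W + c + d)) + (e * L / 4 + 1 / 4 * f))
            = (n * (\<phi> * P + e)) * (z / 4 * L) + 1 / 4 * (\<phi> * (v * W + v * (c + d)) + v * f)"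
          if "v = n * z" for v \<phi> P L W c d e f n z :: real
          unfolding that by (simp add: field_simps)
        show ?thesis
          unfolding M_def E_def e1 e2 e3 e4[OF refl] by (simp add: mult_ac)
      qed
      also have "\<dots> = ((max 0 (\<psi> - 1)) ^ 4 * p powr (1 + \<alpha>) - 2 * (\<psi> ^ 4 * y powr (1 + \<alpha>))
            + (\<psi> + 1) ^ 4 * q powr (1 + \<alpha>))
          * (y\<^sup>2 / 4 * (4 * y * (p - 2 * y + q) + (p - y)\<^sup>2 + (q - y)\<^sup>2))
        + 1 / 4 * (\<psi> ^ 4 * (y powr (2 + \<alpha>) * ((p - y) ^ 3 + (q - y) ^ 3)
                + y powr (1 + \<alpha>) * ((p - y) ^ 4 + (q - y) ^ 4))
            + ((\<psi> + 1) ^ 4 - \<psi> ^ 4) * y powr (1 + \<alpha>) * (q - y) ^ 3 * q)"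
      proof -
        have 1: "m * y\<^sup>2 + m * ((1 + \<alpha>) * y * a + ra) = p powr (1 + \<alpha>)"
          "m * y\<^sup>2 + m * ((1 + \<alpha>) * y * b + rb) = q powr (1 + \<alpha>)"
          using ra(3) rb(3) y1 unfolding m_def[symmetric] by linarith+
        have 2: "\<psi> ^ 4 - g = (max 0 (\<psi> - 1)) ^ 4" "\<psi> ^ 4 + k = (\<psi> + 1) ^ 4" 
          by (simp_all add: g_def k_def)
        have 3: "a + b = p - 2 * y + q" "y + b = q" by (simp_all add: a_def b_def)
        show ?thesis unfolding 1 2 3 y1 y2 unfolding a_def b_def k_def ..
      qed
      finally have fin: "m * y\<^sup>2 * (1 / 200 * \<psi> ^ 4 * Q - 8 * C * (y ^ 4 + Q)) \<le> \<dots>" .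
      have "1 / 200 * \<psi> ^ 4 * y powr (1 + \<alpha>) * ((p - y) ^ 4 + (q - y) ^ 4)
          - 8 * C * y powr (1 + \<alpha>) * (y ^ 4 + (p - y) ^ 4 + (q - y) ^ 4)
        = m * y\<^sup>2 * (1 / 200 * \<psi> ^ 4 * Q - 8 * C * (y ^ 4 + Q))"
        unfolding y1 Q_def a_def b_def by (simp add: algebra_simps)
      then show ?thesis using fin by simp
    qed simp
  qed (use C in auto)
qed

subsection \<open>Dissipation of weighted sums of powers\<close>

definition cutoff :: "nat \<Rightarrow> int \<Rightarrow> real" where
  "cutoff N j = (max 0 (real_of_int (int N - j))) ^ 4"

text \<open>The bracket of the evolution equation with unit mesh width, after expanding the
  Laplacian of \<open>z^2\<close> as twice \<open>z\<close> times the Laplacian of \<open>z\<close>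
  plus the squares of both one-sided differences. The factor \<open>z^2\<close> makes it vanish
  outside the mesh.\<close>

definition flux :: "(int \<Rightarrow> real) \<Rightarrow> int \<Rightarrow> real" where
  "flux z j = (z j)\<^sup>2 / 4 * (4 * z j * (z (j + 1) - 2 * z j + z (j - 1))
     + (z (j + 1) - z j)\<^sup>2 + (z (j - 1) - z j)\<^sup>2)"

definition dissipation :: "real \<Rightarrow> (int \<Rightarrow> real) \<Rightarrow> int \<Rightarrow> real" where
  "dissipation \<alpha> z j = z j powr (1 + \<alpha>) * ((z (j + 1) - z j) ^ 4 + (z (j - 1) - z j) ^ 4)"

lemma cutoff_nonneg [simp]: "0 \<le> cutoff N j"
  by (simp add: cutoff_def)

lemma dissipation_nonneg [simp]: "0 \<le> dissipation \<alpha> z j"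
  by (simp add: dissipation_def)

text \<open>The window \<open>{-1..int K}\<close> has an empty cell at either end, so a unit shift
  pushes nothing out of it.\<close>

lemma sum_int_shift:
  fixes g :: "int \<Rightarrow> real"
  assumes "\<And>j. j \<notin> {0..<int K} \<Longrightarrow> g j = 0"
  shows "(\<Sum>j\<in>{-1..int K}. g (j + 1)) = (\<Sum>j\<in>{-1..int K}. g j)"
    and "(\<Sum>j\<in>{-1..int K}. g (j - 1)) = (\<Sum>j\<in>{-1..int K}. g j)"
proof -
  have r: "(\<Sum>j\<in>{-1..int K}. g j) = (\<Sum>j\<in>{0..<int K}. g j)"
    using assms by (intro sum.mono_neutral_right) auto
  have "(\<Sum>j\<in>{-1..int K}. g (j + 1)) = (\<Sum>j\<in>{0..int K + 1}. g j)"
    by (rule sum.reindex_bij_witness[of _ "\<lambda>j. j - 1" "\<lambda>j. j + 1"]) auto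
  also have "\<dots> = (\<Sum>j\<in>{0..<int K}. g j)"
    using assms by (intro sum.mono_neutral_right) auto
  finally show "(\<Sum>j\<in>{-1..int K}. g (j + 1)) = (\<Sum>j\<in>{-1..int K}. g j)" using r by simp
  have "(\<Sum>j\<in>{-1..int K}. g (j - 1)) = (\<Sum>j\<in>{-2..int K - 1}. g j)"
    by (rule sum.reindex_bij_witness[of _ "\<lambda>j. j + 1" "\<lambda>j. j - 1"]) auto
  also have "\<dots> = (\<Sum>j\<in>{0..<int K}. g j)"
    using assms by (intro sum.mono_neutral_right) auto
  finally show "(\<Sum>j\<in>{-1..int K}. g (j - 1)) = (\<Sum>j\<in>{-1..int K}. g j)" using r by simp
qed

lemma sum_by_parts:
  fixes w f :: "int \<Rightarrow> real"
  assumes w: "\<And>j. j \<notin> {0..<int K} \<Longrightarrow> w j = 0" and f: "\<And>j. j \<notin> {0..<int K} \<Longrightarrow> f j = 0"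
  shows "(\<Sum>j\<in>{-1..int K}. w j * (f (j + 1) - 2 * f j + f (j - 1)))
    = (\<Sum>j\<in>{-1..int K}. (w (j + 1) - 2 * w j + w (j - 1)) * f j)"
proof -
  have "(\<Sum>j\<in>{-1..int K}. w j * f (j + 1)) = (\<Sum>j\<in>{-1..int K}. w (j - 1) * f j)"
    using sum_int_shift(1)[of K "\<lambda>j. w (j - 1) * f j"] f by simp
  moreover have "(\<Sum>j\<in>{-1..int K}. w j * f (j - 1)) = (\<Sum>j\<in>{-1..int K}. w (j + 1) * f j)"
    using sum_int_shift(2)[of K "\<lambda>j. w (j + 1) * f j"] f by simp
  ultimately show ?thesis
    by (simp add: distrib_left distrib_right left_diff_distrib right_diff_distrib
        sum.distrib sum_subtractf mult_ac)
qed

text \<open>Summing over edges instead of vertices exhibits the sign: an edge with end values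
  \<open>q\<close>, \<open>y\<close> contributes a multiple of \<open>(y - q) * (q powr \<alpha> - y powr \<alpha>)\<close>.\<close>

lemma edge_sum_nonpos:
  fixes z \<phi> :: "int \<Rightarrow> real" and \<alpha> :: real
  assumes z: "\<And>j. 0 \<le> z j" "\<And>j. j \<notin> {0..<int K} \<Longrightarrow> z j = 0" and \<phi>: "\<And>j. 0 \<le> \<phi> j"
    and \<alpha>: "0 < \<alpha>"
  shows "(\<Sum>j\<in>{-1..int K}.
      \<phi> j * (z j powr (2 + \<alpha>) * ((z (j + 1) - z j) ^ 3 + (z (j - 1) - z j) ^ 3)
             + z j powr (1 + \<alpha>) * ((z (j + 1) - z j) ^ 4 + (z (j - 1) - z j) ^ 4))
      + (\<phi> (j - 1) - \<phi> j) * z j powr (1 + \<alpha>) * (z (j - 1) - z j) ^ 3 * z (j - 1)) \<le> 0"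
proof -
  define R where "R j = \<phi> j * (z j powr (2 + \<alpha>) * (z (j + 1) - z j) ^ 3
    + z j powr (1 + \<alpha>) * (z (j + 1) - z j) ^ 4)" for j
  define L where "L j = \<phi> j * (z j powr (2 + \<alpha>) * (z (j - 1) - z j) ^ 3
      + z j powr (1 + \<alpha>) * (z (j - 1) - z j) ^ 4)
    + (\<phi> (j - 1) - \<phi> j) * z j powr (1 + \<alpha>) * (z (j - 1) - z j) ^ 3 * z (j - 1)" for j
  have edge: "R (j - 1) + L j \<le> 0" for j
  proof -
    define q y where "q = z (j - 1)" and "y = z j"
    have qy: "0 \<le> q" "0 \<le> y" by (simp_all add: q_def y_def z)
    have p2: "u powr (2 + \<alpha>) = u\<^sup>2 * u powr \<alpha>" and p1: "u powr (1 + \<alpha>) = u * u powr \<alpha>"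
      if "0 \<le> u" for u :: real
      using that by (simp_all add: powr_add)
    \<comment> \<open>As \<open>y + (q - y) = q\<close>, the cubic and quartic terms at
      \<open>y\<close> merge into \<open>y powr (1 + \<alpha>) * q * (q - y) ^ 3\<close>, and
      likewise at \<open>q\<close>. The last term of \<open>L\<close> changes the weight at
      \<open>y\<close> from \<open>\<phi> j\<close> to \<open>\<phi> (j - 1)\<close>, so that both
      ends of the edge are weighted equally.\<close>
    have "R (j - 1) + L j = - (\<phi> (j - 1) * ((y - q)\<^sup>2 * (q * y) * ((y - q) * (y powr \<alpha> - q powr \<alpha>))))"
      unfolding R_def L_def q_def[symmetric] y_def[symmetric] diff_add_cancel p2[OF qy(1)]
        p2[OF qy(2)] p1[OF qy(1)] p1[OF qy(2)]
      by (simp add: power2_eq_square power3_eq_cube power4_eq_xxxx algebra_simps)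
    moreover have "0 \<le> (y - q) * (y powr \<alpha> - q powr \<alpha>)"
    proof (cases "q \<le> y")
      case True
      then show ?thesis using qy \<alpha> by (intro mult_nonneg_nonneg) (auto intro: powr_mono2)
    next
      case False
      then show ?thesis using qy \<alpha> by (intro mult_nonpos_nonpos) (auto intro: powr_mono2)
    qed
    ultimately show ?thesis using qy \<phi>[of "j - 1"] by simp
  qed
  have "(\<Sum>j\<in>{-1..int K}. R j) = (\<Sum>j\<in>{-1..int K}. R (j - 1))"
    using z(2) by (intro sum_int_shift(2)[symmetric]) (auto simp: R_def)
  then have "(\<Sum>j\<in>{-1..int K}. R j + L j) = (\<Sum>j\<in>{-1..int K}. R (j - 1) + L j)"
    by (simp add: sum.distrib)
  also have "\<dots> \<le> 0" by (intro sum_nonpos edge)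
  finally show ?thesis
    by (simp add: R_def L_def algebra_simps)
qed

lemma powr_difference_bound:
  fixes y p \<alpha> :: real
  assumes "0 \<le> y" "0 \<le> p" "0 < \<alpha>"
  shows "y powr (1 + \<alpha>) * (p - y) ^ 4 \<le> y powr (5 + \<alpha>) + p powr (5 + \<alpha>)"
proof -
  define m where "m = max y p"
  have 4: "u powr (5 + \<alpha>) = u powr (1 + \<alpha>) * u ^ 4" if "0 \<le> u" for u :: real
  proof (cases "u = 0")
    case False
    with that show ?thesis
      using powr_add[of u "1 + \<alpha>" 4] by (simp add: ac_simps)
  qed simp
  have "y powr (1 + \<alpha>) * (p - y) ^ 4 = y powr (1 + \<alpha>) * \<bar>p - y\<bar> ^ 4" by simp
  also have "\<dots> \<le> m powr (1 + \<alpha>) * m ^ 4"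
    using assms by (intro mult_mono powr_mono2 power_mono) (auto simp: m_def)
  also have "\<dots> = m powr (5 + \<alpha>)" using assms by (simp add: 4 m_def)
  also have "\<dots> \<le> y powr (5 + \<alpha>) + p powr (5 + \<alpha>)" by (simp add: m_def max_def)
  finally show ?thesis .
qed

text \<open>Summation by parts moves the second difference from the flux to the weighted power.
  Adding a quarter of the nonpositive edge sum only lowers the result and makes the vertex estimate
  applicable.\<close>

lemma energy_dissipation:
  fixes \<alpha> :: real
  assumes \<alpha>: "0 < \<alpha>" "\<alpha> < 1 / 32"
  obtains C where "0 \<le> C" and
    "\<And>(z :: int \<Rightarrow> real) K N. (\<And>j. 0 \<le> z j) \<Longrightarrow> (\<And>j. j \<notin> {0..<int K} \<Longrightarrow> z j = 0) \<Longrightarrow>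
      1 / 200 * (\<Sum>j\<in>{-1..int K}. cutoff N j * dissipation \<alpha> z j)
        - C * (\<Sum>j\<in>{0..int N + 1}. z j powr (5 + \<alpha>))
      \<le> (\<Sum>j\<in>{-1..int K}. cutoff N j * z j powr (1 + \<alpha>)
            * (flux z (j + 1) - 2 * flux z j + flux z (j - 1)))"
proof -
  obtain C where C: "0 \<le> C" and vertex:
    "\<And>y p q \<psi> :: real. 0 \<le> y \<Longrightarrow> 0 \<le> p \<Longrightarrow> 0 \<le> q \<Longrightarrow> \<psi> = 0 \<or> 1 \<le> \<psi> \<Longrightarrow>
      1 / 200 * \<psi> ^ 4 * y powr (1 + \<alpha>) * ((p - y) ^ 4 + (q - y) ^ 4)
        - C * y powr (1 + \<alpha>) * (y ^ 4 + (p - y) ^ 4 + (q - y) ^ 4)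
      \<le> ((max 0 (\<psi> - 1)) ^ 4 * p powr (1 + \<alpha>) - 2 * (\<psi> ^ 4 * y powr (1 + \<alpha>))
            + (\<psi> + 1) ^ 4 * q powr (1 + \<alpha>))
          * (y\<^sup>2 / 4 * (4 * y * (p - 2 * y + q) + (p - y)\<^sup>2 + (q - y)\<^sup>2))
        + 1 / 4 * (\<psi> ^ 4 * (y powr (2 + \<alpha>) * ((p - y) ^ 3 + (q - y) ^ 3)
                + y powr (1 + \<alpha>) * ((p - y) ^ 4 + (q - y) ^ 4))
            + ((\<psi> + 1) ^ 4 - \<psi> ^ 4) * y powr (1 + \<alpha>) * (q - y) ^ 3 * q)"
    using vertex_dissipation[OF \<alpha>] by blast
  show thesis
  proof (rule that[of "5 * C"])
    fix z :: "int \<Rightarrow> real" and K N :: nat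
    assume z: "\<And>j. 0 \<le> z j" "\<And>j. j \<notin> {0..<int K} \<Longrightarrow> z j = 0"
    let ?J = "{-1..int K}"
    define \<phi> where "\<phi> = cutoff N"
    define w where "w j = \<phi> j * z j powr (1 + \<alpha>)" for j
    define V where "V j = (w (j + 1) - 2 * w j + w (j - 1)) * flux z j" for j
    define E where "E j = \<phi> j * (z j powr (2 + \<alpha>) * ((z (j + 1) - z j) ^ 3 + (z (j - 1) - z j) ^ 3)
             + z j powr (1 + \<alpha>) * ((z (j + 1) - z j) ^ 4 + (z (j - 1) - z j) ^ 4))
      + (\<phi> (j - 1) - \<phi> j) * z j powr (1 + \<alpha>) * (z (j - 1) - z j) ^ 3 * z (j - 1)" for j
    define P where "P j = z j powr (5 + \<alpha>)" for j
    \<comment> \<open>The vertex \<open>j = N\<close> has weight \<open>0\<close> but still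
      contributes, because its left neighbour has weight \<open>1\<close>; its right neighbour makes
      the error sum extend to \<open>N + 1\<close>. The coefficients \<open>3\<close>,
      \<open>1\<close>, \<open>1\<close> come from \<open>powr_difference_bound\<close> and add up
      to the factor \<open>5\<close>.\<close>
    define B where "B j = (if 0 \<le> j \<and> j \<le> int N then 3 * P j + P (j + 1) + P (j - 1) else 0)" for j
    have P0: "0 \<le> P j" for j by (simp add: P_def)
    have local: "1 / 200 * (\<phi> j * dissipation \<alpha> z j) - C * B j \<le> V j + 1 / 4 * E j" for j
    proof (cases "0 \<le> j \<and> j \<le> int N")
      case True
      define \<psi> where "\<psi> = real_of_int (int N - j)"
      have "int N - j = 0 \<or> 1 \<le> int N - j" using True by linarith
      then have \<psi>: "\<psi> = 0 \<or> 1 \<le> \<psi>" "0 \<le> \<psi>"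
        unfolding \<psi>_def by (simp_all only: of_int_1_le_iff of_int_0_eq_iff) (use True in auto)
      have c: "\<phi> j = \<psi> ^ 4" "\<phi> (j + 1) = (max 0 (\<psi> - 1)) ^ 4" "\<phi> (j - 1) = (\<psi> + 1) ^ 4"
        using True by (auto simp: \<phi>_def cutoff_def \<psi>_def algebra_simps max_def)
      have "z j powr (1 + \<alpha>) * (z j ^ 4 + (z (j + 1) - z j) ^ 4 + (z (j - 1) - z j) ^ 4)
          \<le> B j"
      proof -
        have "z j powr (1 + \<alpha>) * z j ^ 4 \<le> P j"
          unfolding P_def using powr_difference_bound[of "z j" 0 \<alpha>] z(1) \<alpha>(1) by simp
        then show ?thesis
          using True powr_difference_bound[of "z j" "z (j + 1)" \<alpha>]
            powr_difference_bound[of "z j" "z (j - 1)" \<alpha>] z(1) \<alpha>(1)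
          by (simp add: B_def P_def distrib_left)
      qed
      then have "C * z j powr (1 + \<alpha>) * (z j ^ 4 + (z (j + 1) - z j) ^ 4 + (z (j - 1) - z j) ^ 4)
          \<le> C * B j"
        unfolding mult.assoc by (rule mult_left_mono[OF _ C])
      then show ?thesis
        using vertex[OF z(1) z(1) z(1) \<psi>(1), of j "j + 1" "j - 1"]
        unfolding V_def E_def w_def flux_def dissipation_def c by (simp add: mult.assoc)
    next
      case False
      then consider "j < 0" | "int N < j" by linarith
      then have "V j = 0 \<and> E j = 0 \<and> \<phi> j * dissipation \<alpha> z j = 0"
      proof cases
        case 1
        then show ?thesis using z(2) by (simp add: V_def E_def dissipation_def flux_def)
      next
        case 2
        then have "\<phi> j = 0" "\<phi> (j - 1) = 0" "\<phi> (j + 1) = 0" by (auto simp: \<phi>_def cutoff_def)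
        then show ?thesis by (simp add: V_def E_def w_def)
      qed
      moreover have "B j = 0" using False by (auto simp: B_def)
      ultimately show ?thesis by auto
    qed
    have "1 / 200 * (\<Sum>j\<in>?J. \<phi> j * dissipation \<alpha> z j) - C * (\<Sum>j\<in>?J. B j)
        = (\<Sum>j\<in>?J. 1 / 200 * (\<phi> j * dissipation \<alpha> z j) - C * B j)"
      by (simp add: sum_subtractf sum_distrib_left)
    also have "\<dots> \<le> (\<Sum>j\<in>?J. V j + 1 / 4 * E j)" by (intro sum_mono local)
    also have "\<dots> = (\<Sum>j\<in>?J. V j) + 1 / 4 * (\<Sum>j\<in>?J. E j)"
      by (simp add: sum.distrib sum_distrib_left)
    also have "(\<Sum>j\<in>?J. E j) \<le> 0"
      unfolding E_def by (rule edge_sum_nonpos[OF z _ \<alpha>(1)]) (auto simp: \<phi>_def)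
    also have "(\<Sum>j\<in>?J. V j) = (\<Sum>j\<in>?J. w j * (flux z (j + 1) - 2 * flux z j + flux z (j - 1)))"
      unfolding V_def using z(2) by (intro sum_by_parts[symmetric]) (auto simp: w_def flux_def)
    finally have main: "1 / 200 * (\<Sum>j\<in>?J. \<phi> j * dissipation \<alpha> z j) - C * (\<Sum>j\<in>?J. B j)
      \<le> (\<Sum>j\<in>?J. w j * (flux z (j + 1) - 2 * flux z j + flux z (j - 1)))" by simp
    have "(\<Sum>j\<in>?J. B j) \<le> (\<Sum>j\<in>?J \<union> {0..int N}. B j)"
      using P0 by (intro sum_mono2) (auto simp: B_def)
    also have "\<dots> = (\<Sum>j\<in>{0..int N}. B j)"
      by (intro sum.mono_neutral_right) (auto simp: B_def)
    also have "\<dots> = 3 * (\<Sum>j\<in>{0..int N}. P j) + (\<Sum>j\<in>{0..int N}. P (j + 1)) + (\<Sum>j\<in>{0..int N}. P (j - 1))"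
      by (simp add: B_def sum.distrib sum_distrib_left)
    also have "\<dots> \<le> 5 * (\<Sum>j\<in>{0..int N + 1}. P j)"
    proof -
      have "(\<Sum>j\<in>{0..int N}. P j) \<le> (\<Sum>j\<in>{0..int N + 1}. P j)"
        using P0 by (intro sum_mono2) auto
      moreover have "(\<Sum>j\<in>{0..int N}. P (j + 1)) = (\<Sum>j\<in>{1..int N + 1}. P j)"
        by (rule sum.reindex_bij_witness[of _ "\<lambda>j. j - 1" "\<lambda>j. j + 1"]) auto
      moreover have "(\<Sum>j\<in>{1..int N + 1}. P j) \<le> (\<Sum>j\<in>{0..int N + 1}. P j)"
        using P0 by (intro sum_mono2) auto
      moreover have "(\<Sum>j\<in>{0..int N}. P (j - 1)) = (\<Sum>j\<in>{-1..int N - 1}. P j)"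
        by (rule sum.reindex_bij_witness[of _ "\<lambda>j. j + 1" "\<lambda>j. j - 1"]) auto
      moreover have "(\<Sum>j\<in>{-1..int N - 1}. P j) = (\<Sum>j\<in>{0..int N - 1}. P j)"
        using z(2) by (intro sum.mono_neutral_right) (auto simp: P_def)
      moreover have "(\<Sum>j\<in>{0..int N - 1}. P j) \<le> (\<Sum>j\<in>{0..int N + 1}. P j)"
        using P0 by (intro sum_mono2) auto
      ultimately show ?thesis by linarith
    qed
    finally have "C * (\<Sum>j\<in>?J. B j) \<le> 5 * C * (\<Sum>j\<in>{0..int N + 1}. P j)"
      using mult_left_mono[OF _ C] by fastforce
    with main show "1 / 200 * (\<Sum>j\<in>?J. cutoff N j * dissipation \<alpha> z j)
        - 5 * C * (\<Sum>j\<in>{0..int N + 1}. z j powr (5 + \<alpha>))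
      \<le> (\<Sum>j\<in>?J. cutoff N j * z j powr (1 + \<alpha>)
            * (flux z (j + 1) - 2 * flux z j + flux z (j - 1)))"
      by (simp add: \<phi>_def w_def P_def)
  qed (use C in auto)
qed

subsection \<open>Interpolation at a given mass scale\<close>

lemma sum_power4_le:
  fixes x :: "'a \<Rightarrow> real"
  assumes "finite A"
  shows "(\<Sum>i\<in>A. x i) ^ 4 \<le> real (card A) ^ 3 * (\<Sum>i\<in>A. x i ^ 4)"
proof -
  have "(\<Sum>i\<in>A. x i) ^ 4 = ((\<Sum>i\<in>A. x i)\<^sup>2)\<^sup>2" by simp
  also have "\<dots> \<le> ((\<Sum>i\<in>A. (x i)\<^sup>2) * real (card A))\<^sup>2"
    by (intro power_mono sum_squared_le_sum_of_squares assms) auto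
  also have "\<dots> = (\<Sum>i\<in>A. (x i)\<^sup>2)\<^sup>2 * (real (card A))\<^sup>2" by (simp add: power_mult_distrib)
  also have "\<dots> \<le> (\<Sum>i\<in>A. ((x i)\<^sup>2)\<^sup>2) * real (card A) * (real (card A))\<^sup>2"
    by (intro mult_right_mono sum_squared_le_sum_of_squares assms) auto
  also have "\<dots> = real (card A) ^ 3 * (\<Sum>i\<in>A. x i ^ 4)"
    by (simp add: power2_eq_square power3_eq_cube power4_eq_xxxx algebra_simps)
  finally show ?thesis .
qed

lemma abs_diff_le_sum_increments:
  fixes v :: "int \<Rightarrow> real"
  assumes "a \<le> b"
  shows "\<bar>v b - v a\<bar> \<le> (\<Sum>k\<in>{a..<b}. \<bar>v (k + 1) - v k\<bar>)"
  using assms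
proof (induction b rule: int_ge_induct)
  case (step i)
  have "{a..<i + 1} = insert i {a..<i}" using step by auto
  then show ?case using step by simp
qed simp

lemma powr_increment_bound:
  fixes y p \<beta> :: real
  assumes "0 \<le> y" "y \<le> p" "0 < \<beta>"
  shows "p powr (1 + \<beta>) - y powr (1 + \<beta>) \<le> (1 + \<beta>) * p powr \<beta> * (p - y)"
proof (cases "p = 0")
  case False
  then have p: "0 < p" using assms by simp
  define u where "u = y / p"
  have u: "0 \<le> u" "y = u * p" using assms p by (auto simp: u_def)
  have "p powr (1 + \<beta>) - y powr (1 + \<beta>) = p powr (1 + \<beta>) * (1 - u powr (1 + \<beta>))"
    unfolding u(2) using u(1) p by (simp add: powr_mult algebra_simps)
  also have "\<dots> \<le> p powr (1 + \<beta>) * ((1 + \<beta>) * (1 - u))"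
    using powr_ge_bernoulli[OF u(1) assms(3)] by (intro mult_left_mono) (auto simp: algebra_simps)
  also have "\<dots> = (1 + \<beta>) * p powr \<beta> * (p - y)"
    unfolding u(2) using p by (simp add: powr_add algebra_simps)
  finally show ?thesis .
qed (use assms in auto)

text \<open>The exponent \<open>(5 + \<alpha>) / 4\<close> turns the dissipation into the fourth
  power of an increment. The mean value bound puts the weight on the larger end value, which may be
  either one; both vertices enter because each sees the edge with its own value as weight. The
  \<open>16\<close> is \<open>2 ^ 4\<close>, from \<open>1 + \<beta> \<le> 2\<close>.\<close>

lemma powr_increment_dissipation:
  fixes z :: "int \<Rightarrow> real" and \<alpha> :: real
  assumes z: "\<And>j. 0 \<le> z j" and \<alpha>: "0 < \<alpha>" "\<alpha> < 1"
  shows "\<bar>z (k + 1) powr ((5 + \<alpha>) / 4) - z k powr ((5 + \<alpha>) / 4)\<bar> ^ 4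
    \<le> 16 * (dissipation \<alpha> z k + dissipation \<alpha> z (k + 1))"
proof -
  define \<beta> where "\<beta> = (1 + \<alpha>) / 4"
  have \<beta>: "0 < \<beta>" "1 + \<beta> \<le> 2" "(5 + \<alpha>) / 4 = 1 + \<beta>" using \<alpha> by (auto simp: \<beta>_def field_simps)
  have *: "\<bar>p powr (1 + \<beta>) - y powr (1 + \<beta>)\<bar> ^ 4 \<le> 16 * (p powr (1 + \<alpha>) * (p - y) ^ 4)"
    if "0 \<le> y" "y \<le> p" for y p :: real
  proof -
    have "y powr (1 + \<beta>) \<le> p powr (1 + \<beta>)" using that \<beta> by (intro powr_mono2) auto
    then have "\<bar>p powr (1 + \<beta>) - y powr (1 + \<beta>)\<bar> \<le> (1 + \<beta>) * p powr \<beta> * (p - y)"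
      using powr_increment_bound[OF that \<beta>(1)] by simp
    also have "\<dots> \<le> 2 * p powr \<beta> * (p - y)"
      using that \<beta> by (intro mult_right_mono) auto
    finally have "\<bar>p powr (1 + \<beta>) - y powr (1 + \<beta>)\<bar> ^ 4 \<le> (2 * p powr \<beta> * (p - y)) ^ 4"
      by (rule power_mono) auto
    also have "\<dots> = 16 * ((p powr \<beta>) ^ 4 * (p - y) ^ 4)" by (simp add: power_mult_distrib)
    also have "(p powr \<beta>) ^ 4 = p powr (1 + \<alpha>)"
      using that by (cases "p = 0") (auto simp: \<beta>_def powr_powr add_divide_distrib distrib_right simp flip: powr_numeral)
    finally show ?thesis .
  qed
  have sym: "(z (k + 1) - z k) ^ 4 = (z k - z (k + 1)) ^ 4"
    by (simp add: power4_eq_xxxx algebra_simps)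
  show ?thesis
  proof (cases "z k \<le> z (k + 1)")
    case True
    have "16 * (z (k + 1) powr (1 + \<alpha>) * (z (k + 1) - z k) ^ 4)
      \<le> 16 * (dissipation \<alpha> z k + dissipation \<alpha> z (k + 1))"
    proof -
      have "z (k + 1) powr (1 + \<alpha>) * (z (k + 1) - z k) ^ 4 \<le> dissipation \<alpha> z (k + 1)"
        unfolding dissipation_def sym by (intro mult_left_mono) auto
      then show ?thesis using dissipation_nonneg[of \<alpha> z k] by argo
    qed
    then show ?thesis using *[OF z True] unfolding \<beta>(3) by linarith
  next
    case False
    have "16 * (z k powr (1 + \<alpha>) * (z k - z (k + 1)) ^ 4)
      \<le> 16 * (dissipation \<alpha> z k + dissipation \<alpha> z (k + 1))"
    proof -
      have "z k powr (1 + \<alpha>) * (z k - z (k + 1)) ^ 4 \<le> dissipation \<alpha> z k"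
        unfolding dissipation_def sym[symmetric] by (intro mult_left_mono) auto
      then show ?thesis using dissipation_nonneg[of \<alpha> z "k + 1"] by argo
    qed
    then show ?thesis using *[OF z, of "k + 1" "z k"] False unfolding \<beta>(3)
      by (simp add: abs_minus_commute)
  qed
qed

text \<open>Among \<open>L\<close> consecutive cells including \<open>j\<close>, some cell
  \<open>i\<close> has \<open>z i powr \<alpha>\<close> at most \<open>S / L\<close>. Going from
  \<open>i\<close> to \<open>j\<close> crosses at most \<open>L - 1\<close> edges, and the power
  mean inequality for their increments gives the cube. In \<open>256 = 8 * 32\<close>, the
  \<open>32\<close> is \<open>16\<close> for each of the two vertices of an edge.\<close>

lemma pointwise_window_bound:
  fixes z :: "int \<Rightarrow> real" and \<alpha> :: real
  assumes z: "\<And>j. 0 \<le> z j" and \<alpha>: "0 < \<alpha>" "\<alpha> < 1"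
    and L: "1 \<le> L" "L \<le> n + 1" and j: "0 \<le> j" "j \<le> int n"
  shows "z j powr (5 + \<alpha>)
    \<le> 8 * ((\<Sum>k\<in>{0..int n}. z k powr \<alpha>) / real L) powr ((5 + \<alpha>) / \<alpha>)
      + 256 * (real L - 1) ^ 3 * (\<Sum>k\<in>{0..int n}. dissipation \<alpha> z k)"
proof -
  define S where "S = (\<Sum>k\<in>{0..int n}. z k powr \<alpha>)"
  define G where "G = (\<Sum>k\<in>{0..int n}. dissipation \<alpha> z k)"
  \<comment> \<open>The window starts at \<open>j\<close>, or is pushed left just enough to end at
    \<open>n\<close>.\<close>
  define s where "s = min j (int n + 1 - int L)"
  define e where "e = s + int L - 1"
  have s: "0 \<le> s" "e \<le> int n" "s \<le> j" "j \<le> e" using L j by (auto simp: s_def e_def)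
  define v where "v k = z k powr ((5 + \<alpha>) / 4)" for k
  have v0: "0 \<le> v k" for k by (simp add: v_def)
  have v4: "v k ^ 4 = z k powr (5 + \<alpha>)" for k
    using z[of k] by (cases "z k = 0") (auto simp: v_def powr_powr add_divide_distrib distrib_right simp flip: powr_numeral)
  have ci: "card {s..e} = L" using L by (simp add: e_def)
  obtain i where i: "i \<in> {s..e}" "z i powr \<alpha> \<le> S / real L"
  proof -
    have "(\<Sum>k\<in>{s..e}. z k powr \<alpha>) \<le> S"
      unfolding S_def using s by (intro sum_mono2) auto
    moreover have "\<not> (\<forall>k\<in>{s..e}. S / real L < z k powr \<alpha>)"
    proof
      assume "\<forall>k\<in>{s..e}. S / real L < z k powr \<alpha>"
      then have "(\<Sum>k\<in>{s..e}. S / real L) < (\<Sum>k\<in>{s..e}. z k powr \<alpha>)"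
        using s by (intro sum_strict_mono) auto
      then show False using calculation L ci by simp
    qed
    ultimately show thesis using that by force
  qed
  define a b where "a = min i j" and "b = max i j"
  have ab: "a \<le> b" "s \<le> a" "b \<le> e" using i s by (auto simp: a_def b_def)
  have "v j \<le> v i + \<bar>v b - v a\<bar>" by (auto simp: a_def b_def min_def max_def)
  also have "\<bar>v b - v a\<bar> \<le> (\<Sum>k\<in>{a..<b}. \<bar>v (k + 1) - v k\<bar>)"
    by (rule abs_diff_le_sum_increments[OF ab(1)])
  finally have "v j ^ 4 \<le> (v i + (\<Sum>k\<in>{a..<b}. \<bar>v (k + 1) - v k\<bar>)) ^ 4"
    using v0 by (intro power_mono) auto
  also have "\<dots> \<le> 8 * v i ^ 4 + 8 * (\<Sum>k\<in>{a..<b}. \<bar>v (k + 1) - v k\<bar>) ^ 4"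
    by (rule power4_add_le)
  also have "v i ^ 4 \<le> (S / real L) powr ((5 + \<alpha>) / \<alpha>)"
  proof -
    have "v i ^ 4 = (z i powr \<alpha>) powr ((5 + \<alpha>) / \<alpha>)"
      using \<alpha> by (simp add: v4 powr_powr)
    also have "\<dots> \<le> (S / real L) powr ((5 + \<alpha>) / \<alpha>)"
      using i(2) \<alpha> by (intro powr_mono2) auto
    finally show ?thesis .
  qed
  also have "(\<Sum>k\<in>{a..<b}. \<bar>v (k + 1) - v k\<bar>) ^ 4
      \<le> real (card {a..<b}) ^ 3 * (\<Sum>k\<in>{a..<b}. \<bar>v (k + 1) - v k\<bar> ^ 4)"
    by (rule sum_power4_le) simp
  also have "\<dots> \<le> (real L - 1) ^ 3 * (32 * G)"
  proof (rule mult_mono)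
    have "real (card {a..<b}) \<le> real L - 1"
    proof -
      have "b - a \<le> int L - 1" using ab by (simp add: e_def)
      then show ?thesis using L by simp
    qed
    then show "real (card {a..<b}) ^ 3 \<le> (real L - 1) ^ 3" by (intro power_mono) auto
    have "(\<Sum>k\<in>{a..<b}. \<bar>v (k + 1) - v k\<bar> ^ 4)
      \<le> (\<Sum>k\<in>{a..<b}. 16 * (dissipation \<alpha> z k + dissipation \<alpha> z (k + 1)))"
      unfolding v_def by (intro sum_mono powr_increment_dissipation z \<alpha>)
    also have "\<dots> = 16 * ((\<Sum>k\<in>{a..<b}. dissipation \<alpha> z k) + (\<Sum>k\<in>{a..<b}. dissipation \<alpha> z (k + 1)))"
      by (simp add: sum_distrib_left sum.distrib)
    also have "(\<Sum>k\<in>{a..<b}. dissipation \<alpha> z (k + 1)) = (\<Sum>k\<in>{a+1..b}. dissipation \<alpha> z k)"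
      by (rule sum.reindex_bij_witness[of _ "\<lambda>j. j - 1" "\<lambda>j. j + 1"]) auto
    also have "\<dots> \<le> G" unfolding G_def using ab s by (intro sum_mono2) auto
    also have "(\<Sum>k\<in>{a..<b}. dissipation \<alpha> z k) \<le> G"
      unfolding G_def using ab s by (intro sum_mono2) auto
    finally show "(\<Sum>k\<in>{a..<b}. \<bar>v (k + 1) - v k\<bar> ^ 4) \<le> 32 * G" by simp
  qed (use L in \<open>auto intro: sum_nonneg\<close>)
  finally show ?thesis unfolding v4 S_def G_def by simp
qed

lemma sum_cutoff_lower_bound:
  fixes g :: "int \<Rightarrow> real"
  assumes g: "\<And>j. 0 \<le> g j" "\<And>j. j \<notin> {0..<int K} \<Longrightarrow> g j = 0"
  shows "real N ^ 4 * (\<Sum>j\<in>{0..2 * int N}. g j) \<le> (\<Sum>j\<in>{-1..int K}. cutoff (4 * N) j * g j)"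
proof -
  have "(\<Sum>j\<in>{0..2 * int N}. g j) = (\<Sum>j\<in>{0..2 * int N} \<inter> {0..<int K}. g j)"
    using g(2) by (intro sum.mono_neutral_right) auto
  then have "real N ^ 4 * (\<Sum>j\<in>{0..2 * int N}. g j)
      = (\<Sum>j\<in>{0..2 * int N} \<inter> {0..<int K}. real N ^ 4 * g j)"
    by (simp add: sum_distrib_left)
  also have "\<dots> \<le> (\<Sum>j\<in>{0..2 * int N} \<inter> {0..<int K}. cutoff (4 * N) j * g j)"
  proof (intro sum_mono mult_right_mono g)
    fix j assume "j \<in> {0..2 * int N} \<inter> {0..<int K}"
    then have "real N \<le> max 0 (real_of_int (int (4 * N) - j))" by (auto simp: max_def)
    then show "real N ^ 4 \<le> cutoff (4 * N) j" unfolding cutoff_def by (rule power_mono) simp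
  qed
  also have "\<dots> \<le> (\<Sum>j\<in>{-1..int K}. cutoff (4 * N) j * g j)"
    using g(1) by (intro sum_mono2) auto
  finally show ?thesis .
qed

text \<open>The sum on the left reaches the cells \<open>N\<close> and \<open>N + 1\<close>, where
  \<open>cutoff N\<close> vanishes, so a wider cutoff is required: \<open>cutoff (4 * N)\<close> is
  at least \<open>N ^ 4\<close> on \<open>{0..2 * N}\<close>, which contains
  \<open>{0..N + 1}\<close>. The small factor comes from averaging over windows much shorter than
  \<open>N\<close>.\<close>

lemma interpolation:
  fixes \<alpha> \<epsilon> :: real
  assumes \<alpha>: "0 < \<alpha>" "\<alpha> < 1" and \<epsilon>: "0 < \<epsilon>"
  obtains C where "0 \<le> C" and
    "\<And>(z :: int \<Rightarrow> real) K N. (\<And>j. 0 \<le> z j) \<Longrightarrow> (\<And>j. j \<notin> {0..<int K} \<Longrightarrow> z j = 0) \<Longrightarrow> 1 \<le> N \<Longrightarrow>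
      (\<Sum>j\<in>{0..int N + 1}. z j powr (5 + \<alpha>))
      \<le> \<epsilon> * (\<Sum>j\<in>{-1..int K}. cutoff (4 * N) j * dissipation \<alpha> z j)
        + C * real N * ((\<Sum>j\<in>{-1..int K}. cutoff (4 * N) j * z j powr \<alpha>) / real N ^ 5)
            powr ((5 + \<alpha>) / \<alpha>)"
proof -
  define p where "p = (5 + \<alpha>) / \<alpha>"
  have p: "0 < p" using \<alpha> by (simp add: p_def)
  \<comment> \<open>The relative window length. \<open>768 = 3 * 256\<close>, because the at most
    \<open>3 * N\<close> cells of the sum each pay the factor \<open>256\<close> of
    \<open>pointwise_window_bound\<close>.\<close>
  define \<theta> where "\<theta> = min 1 (\<epsilon> / 768)"
  have \<theta>: "0 < \<theta>" "\<theta> \<le> 1" "768 * \<theta> \<le> \<epsilon>" using \<epsilon> by (auto simp: \<theta>_def)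
  have \<theta>3: "768 * \<theta> ^ 3 \<le> \<epsilon>"
  proof -
    have "\<theta> ^ 3 \<le> \<theta> ^ 1" using \<theta> by (intro power_decreasing) auto
    then show ?thesis using \<theta>(3) by simp
  qed
  show thesis
  proof (rule that[of "24 * (1 / \<theta>) powr p"])
    fix z :: "int \<Rightarrow> real" and K N :: nat
    assume z: "\<And>j. 0 \<le> z j" "\<And>j. j \<notin> {0..<int K} \<Longrightarrow> z j = 0" and N: "1 \<le> N"
    define A where "A = (\<Sum>j\<in>{-1..int K}. cutoff (4 * N) j * z j powr \<alpha>)"
    define D where "D = (\<Sum>j\<in>{-1..int K}. cutoff (4 * N) j * dissipation \<alpha> z j)"
    define S where "S = (\<Sum>j\<in>{0..2 * int N}. z j powr \<alpha>)"
    define G where "G = (\<Sum>j\<in>{0..2 * int N}. dissipation \<alpha> z j)"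
    have S: "real N ^ 4 * S \<le> A" "0 \<le> S"
      unfolding S_def A_def using z(2) by (auto intro!: sum_cutoff_lower_bound sum_nonneg)
    have G: "real N ^ 4 * G \<le> D" "0 \<le> G"
      unfolding G_def D_def using z(2)
      by (auto intro!: sum_cutoff_lower_bound sum_nonneg simp: dissipation_def)
    \<comment> \<open>Counting \<open>L - 1\<close> edges instead of \<open>L\<close> cells matters:
      \<open>L - 1 \<le> \<theta> * N\<close> survives for small \<open>\<theta> * N\<close>, when
      the window shrinks to one cell and no dissipation is spent.\<close>
    define L where "L = nat \<lceil>\<theta> * real N\<rceil>"
    have N0: "0 < real N" using N by simp
    have \<theta>N: "0 < \<theta> * real N" "\<theta> * real N \<le> real N"
      using \<theta> N0 by (auto intro: mult_left_le_one_le)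
    have L: "\<theta> * real N \<le> real L" "real L - 1 \<le> \<theta> * real N" "1 \<le> L" "L \<le> 2 * N + 1"
    proof -
      have r: "real L = of_int \<lceil>\<theta> * real N\<rceil>" using \<theta>N(1) by (simp add: L_def)
      show "\<theta> * real N \<le> real L" "real L - 1 \<le> \<theta> * real N" unfolding r by linarith+
      have "0 < L" using \<theta>N(1) by (simp add: L_def)
      then show "1 \<le> L" by simp
      have "\<lceil>\<theta> * real N\<rceil> \<le> int N" using \<theta>N(2) by (simp add: ceiling_le_iff)
      then have "L \<le> N" unfolding L_def by linarith
      then show "L \<le> 2 * N + 1" by simp
    qed
    have pt: "z j powr (5 + \<alpha>) \<le> 8 * (S / (\<theta> * real N)) powr p + 256 * (\<theta> * real N) ^ 3 * G"
      if "j \<in> {0..int N + 1}" for j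
    proof -
      have "z j powr (5 + \<alpha>) \<le> 8 * (S / real L) powr p + 256 * (real L - 1) ^ 3 * G"
        using pointwise_window_bound[of z \<alpha> L "2 * N" j] z(1) \<alpha> L that N
        by (simp add: S_def G_def p_def)
      also have "(S / real L) powr p \<le> (S / (\<theta> * real N)) powr p"
        using S L p \<theta>N by (intro powr_mono2 divide_left_mono) auto
      also have "256 * (real L - 1) ^ 3 * G \<le> 256 * (\<theta> * real N) ^ 3 * G"
        using L G by (intro mult_right_mono mult_left_mono power_mono) auto
      finally show ?thesis by simp
    qed
    have "(\<Sum>j\<in>{0..int N + 1}. z j powr (5 + \<alpha>))
      \<le> (\<Sum>j\<in>{0..int N + 1}. 8 * (S / (\<theta> * real N)) powr p + 256 * (\<theta> * real N) ^ 3 * G)"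
      by (intro sum_mono pt)
    also have "\<dots> = real (N + 2) * (8 * (S / (\<theta> * real N)) powr p + 256 * (\<theta> * real N) ^ 3 * G)"
      by simp
    also have "\<dots> \<le> (3 * real N) * (8 * (S / (\<theta> * real N)) powr p + 256 * (\<theta> * real N) ^ 3 * G)"
      using N G \<theta>N by (intro mult_right_mono add_nonneg_nonneg) auto
    also have "\<dots> = 768 * \<theta> ^ 3 * (real N ^ 4 * G) + 24 * real N * (S / (\<theta> * real N)) powr p"
      by (simp add: power_mult_distrib power3_eq_cube power4_eq_xxxx algebra_simps)
    also have "\<dots> \<le> \<epsilon> * D + 24 * real N * ((1 / \<theta>) powr p * (A / real N ^ 5) powr p)"
    proof (intro add_mono mult_left_mono)
      show "768 * \<theta> ^ 3 * (real N ^ 4 * G) \<le> \<epsilon> * D"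
        using \<theta>3 G \<epsilon> by (intro mult_mono) auto
      have "(S / (\<theta> * real N)) powr p \<le> (1 / \<theta> * (A / real N ^ 5)) powr p"
      proof (rule powr_mono2)
        have "S / (\<theta> * real N) = 1 / \<theta> * ((real N ^ 4 * S) / real N ^ 5)"
          using N0 by (simp add: field_simps power4_eq_xxxx eval_nat_numeral)
        also have "\<dots> \<le> 1 / \<theta> * (A / real N ^ 5)"
          using S \<theta> by (intro mult_left_mono divide_right_mono) auto
        finally show "S / (\<theta> * real N) \<le> 1 / \<theta> * (A / real N ^ 5)" .
      qed (use p S \<theta>N in auto)
      also have "\<dots> = (1 / \<theta>) powr p * (A / real N ^ 5) powr p"
        by (rule powr_mult)
      finally show "(S / (\<theta> * real N)) powr p \<le> (1 / \<theta>) powr p * (A / real N ^ 5) powr p" .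
    qed auto
    finally have "(\<Sum>j\<in>{0..int N + 1}. z j powr (5 + \<alpha>))
      \<le> \<epsilon> * D + 24 * real N * ((1 / \<theta>) powr p * (A / real N ^ 5) powr p)" .
    then show "(\<Sum>j\<in>{0..int N + 1}. z j powr (5 + \<alpha>))
      \<le> \<epsilon> * (\<Sum>j\<in>{-1..int K}. cutoff (4 * N) j * dissipation \<alpha> z j)
        + 24 * (1 / \<theta>) powr p * real N * ((\<Sum>j\<in>{-1..int K}. cutoff (4 * N) j * z j powr \<alpha>) / real N ^ 5)
            powr ((5 + \<alpha>) / \<alpha>)"
      by (simp add: A_def D_def p_def mult_ac)
  qed simp
qed

subsection \<open>Continuation in time\<close>

text \<open>Beyond \<open>2 * K\<close> the family grows at most like \<open>N ^ 4\<close>, hence no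
  faster than \<open>N powr \<gamma>\<close>. This reduces a supremum over all scales to a finite
  maximum.\<close>

lemma scaled_family_bound:
  fixes q :: "nat \<Rightarrow> real"
  assumes \<gamma>: "4 \<le> \<gamma>" "\<gamma> \<le> 6" and K: "1 \<le> K" and b: "0 \<le> b"
    and small: "\<And>N. 1 \<le> N \<Longrightarrow> N \<le> 2 * K \<Longrightarrow> q N \<le> b * real N powr \<gamma>"
    and big: "\<And>N. 2 * K \<le> N \<Longrightarrow> q N \<le> (real N / real K) ^ 4 * q (2 * K)"
    and N: "1 \<le> N"
  shows "q N \<le> 64 * b * real N powr \<gamma>"
proof (cases "N \<le> 2 * K")
  case True
  have "1 * (b * real N powr \<gamma>) \<le> 64 * (b * real N powr \<gamma>)"
    using b by (intro mult_right_mono) auto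
  then show ?thesis using small[OF N True] by simp
next
  case False
  have K0: "0 < real K" and N0: "0 < real N" using K N by auto
  have "q N \<le> (real N / real K) ^ 4 * q (2 * K)" using False by (intro big) auto
  also have "\<dots> \<le> (real N / real K) ^ 4 * (b * real (2 * K) powr \<gamma>)"
    using K by (intro mult_left_mono small) auto
  also have "real (2 * K) powr \<gamma> = 2 powr \<gamma> * (real K ^ 4 * real K powr (\<gamma> - 4))"
  proof -
    have "real K powr \<gamma> = real K powr 4 * real K powr (\<gamma> - 4)"
      using powr_add[of "real K" 4 "\<gamma> - 4"] by simp
    then show ?thesis using K0 by (simp add: powr_mult)
  qed
  also have "(real N / real K) ^ 4 * (b * (2 powr \<gamma> * (real K ^ 4 * real K powr (\<gamma> - 4))))
      = 2 powr \<gamma> * (b * (real N ^ 4 * real K powr (\<gamma> - 4)))"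
    using K0 by (simp add: field_simps)
  also have "\<dots> \<le> 2 powr 6 * (b * (real N ^ 4 * real N powr (\<gamma> - 4)))"
    using \<gamma> b False by (intro mult_mono powr_mono powr_mono2) auto
  also have "real N ^ 4 * real N powr (\<gamma> - 4) = real N powr \<gamma>"
    using powr_add[of "real N" 4 "\<gamma> - 4"] N0 by simp
  finally show ?thesis by simp
qed

text \<open>Quantities at scale \<open>N\<close> are controlled by those at scale \<open>4 * N\<close>. The constants account
  for this loss: \<open>64\<close> bounds \<open>2 powr \<gamma>\<close> (scales \<open>N > 2 * K\<close> are reduced to \<open>2 * K\<close>), \<open>4096\<close> bounds
  \<open>4 powr \<gamma>\<close>, and \<open>262144 = 64 * 4096\<close>.\<close>

lemma bootstrap_step:
  fixes A d e :: "nat \<Rightarrow> real \<Rightarrow> real" and K :: nat and \<alpha> \<kappa> c C \<epsilon> C' B t :: real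
  defines "\<gamma> \<equiv> 5 + 4 / 5 * \<alpha>" and "p \<equiv> (5 + \<alpha>) / \<alpha>"
  assumes \<alpha>: "0 < \<alpha>" "\<alpha> < 1" and K: "1 \<le> K" and \<kappa>: "0 < \<kappa>" and c: "0 < c" and C: "1 \<le> C"
    and \<epsilon>: "0 < \<epsilon>" "262144 * (C * \<epsilon>) \<le> c / 4" and C': "0 \<le> C'" and B: "0 < B" and t: "0 \<le> t"
    and cont: "\<And>N. continuous_on {0..t} (d N)" "\<And>N. continuous_on {0..t} (e N)"
    and nonneg: "\<And>N s. 0 \<le> s \<Longrightarrow> s \<le> t \<Longrightarrow> 0 \<le> A N s" "\<And>N s. 0 \<le> s \<Longrightarrow> s \<le> t \<Longrightarrow> 0 \<le> d N s"
    and energy: "\<And>N. 1 \<le> N \<Longrightarrow>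
      A N t + \<kappa> * (c * integral {0..t} (d N) - C * integral {0..t} (e N)) \<le> A N 0"
    and interp: "\<And>N s. 1 \<le> N \<Longrightarrow> 0 \<le> s \<Longrightarrow> s \<le> t \<Longrightarrow>
      e N s \<le> \<epsilon> * d (4 * N) s + C' * real N * (A (4 * N) s / real N ^ 5) powr p"
    and init: "\<And>N. 1 \<le> N \<Longrightarrow> A N 0 \<le> B * real N powr \<gamma>"
    and big: "\<And>N s. 2 * K \<le> N \<Longrightarrow> 0 \<le> s \<Longrightarrow> s \<le> t \<Longrightarrow>
        A N s \<le> (real N / real K) ^ 4 * A (2 * K) s"
      "\<And>N s. 2 * K \<le> N \<Longrightarrow> 0 \<le> s \<Longrightarrow> s \<le> t \<Longrightarrow>
        d N s \<le> (real N / real K) ^ 4 * d (2 * K) s"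
    and time: "\<kappa> * t * (C * C' * (524288 * B) powr p) \<le> B / 4"
    and bound: "\<And>N s. 1 \<le> N \<Longrightarrow> N \<le> 2 * K \<Longrightarrow> 0 \<le> s \<Longrightarrow> s \<le> t \<Longrightarrow>
        A N s \<le> 2 * B * real N powr \<gamma>"
  shows "\<And>N. 1 \<le> N \<Longrightarrow> A N t < 2 * B * real N powr \<gamma>"
    and "\<kappa> * integral {0..t} (e 1) \<le> B"
proof -
  have \<gamma>: "4 \<le> \<gamma>" "\<gamma> \<le> 6" using \<alpha> by (auto simp: \<gamma>_def)
  have p0: "0 < p" using \<alpha> by (simp add: p_def)
  define I where "I N = integral {0..t} (d N)" for N
  have I0: "0 \<le> I N" for N
    unfolding I_def using nonneg(2) cont by (intro integral_nonneg integrable_continuous_real) auto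
  define R where "R = C' * (524288 * B) powr p"
  have R0: "0 \<le> R" using C' by (simp add: R_def)
  have four: "real (4 * N) powr \<gamma> \<le> 4096 * real N powr \<gamma>" for N
  proof -
    have "4 powr \<gamma> \<le> 4 powr (6::real)" using \<gamma> by (intro powr_mono) auto
    then have "4 powr \<gamma> * real N powr \<gamma> \<le> 4096 * real N powr \<gamma>"
      by (intro mult_right_mono) auto
    then show ?thesis by (simp add: powr_mult)
  qed
  \<comment> \<open>\<open>524288 = 64 * 2 * 4096\<close>, where the \<open>2\<close> is the factor
    allowed by the hypothesis \<open>bound\<close>.\<close>
  have A4: "A (4 * N) s \<le> 524288 * B * real N powr \<gamma>" if "1 \<le> N" "0 \<le> s" "s \<le> t" for N s
  proof -
    have "A (4 * N) s \<le> 64 * (2 * B) * real (4 * N) powr \<gamma>"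
      using that bound big(1) B by (intro scaled_family_bound[OF \<gamma> K]) auto
    also have "\<dots> \<le> 64 * (2 * B) * (4096 * real N powr \<gamma>)"
      using B four by (intro mult_left_mono) auto
    finally show ?thesis by simp
  qed
  have lower: "C' * real N * (A (4 * N) s / real N ^ 5) powr p \<le> R * real N powr \<gamma>"
    if N: "1 \<le> N" and s: "0 \<le> s" "s \<le> t" for N s
  proof -
    have N0: "0 < real N" using N by simp
    have g: "real N powr \<gamma> / real N ^ 5 = real N powr (4 / 5 * \<alpha>)"
      using N0 powr_add[of "real N" 5 "4 / 5 * \<alpha>"] by (simp add: \<gamma>_def)
    have "A (4 * N) s / real N ^ 5 \<le> 524288 * B * real N powr \<gamma> / real N ^ 5"
      using A4[OF N s] by (intro divide_right_mono) auto
    also have "\<dots> = 524288 * B * (real N powr \<gamma> / real N ^ 5)" by simp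
    also have "\<dots> = 524288 * B * real N powr (4 / 5 * \<alpha>)" unfolding g ..
    finally have "(A (4 * N) s / real N ^ 5) powr p \<le> (524288 * B * real N powr (4 / 5 * \<alpha>)) powr p"
      using p0 nonneg(1)[OF s] by (intro powr_mono2) auto
    also have "\<dots> = (524288 * B) powr p * real N powr (4 + 4 / 5 * \<alpha>)"
    proof -
      have "4 / 5 * \<alpha> * p = 4 + 4 / 5 * \<alpha>" using \<alpha> by (simp add: p_def field_simps)
      then show ?thesis by (simp only: powr_mult powr_powr)
    qed
    finally have "C' * real N * (A (4 * N) s / real N ^ 5) powr p
        \<le> C' * real N * ((524288 * B) powr p * real N powr (4 + 4 / 5 * \<alpha>))"
      using C' by (intro mult_left_mono) auto
    also have "\<dots> = R * (real N * real N powr (4 + 4 / 5 * \<alpha>))" by (simp add: R_def)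
    also have "real N * real N powr (4 + 4 / 5 * \<alpha>) = real N powr \<gamma>"
      using powr_add[of "real N" 1 "4 + 4 / 5 * \<alpha>"] N0 by (simp add: \<gamma>_def)
    finally show ?thesis .
  qed
  have E: "integral {0..t} (e N) \<le> \<epsilon> * I (4 * N) + t * R * real N powr \<gamma>" if N: "1 \<le> N" for N
  proof -
    have "integral {0..t} (e N) \<le> integral {0..t} (\<lambda>s. \<epsilon> * d (4 * N) s + R * real N powr \<gamma>)"
    proof (rule integral_le)
      show "e N integrable_on {0..t}" by (intro integrable_continuous_real cont)
      show "(\<lambda>s. \<epsilon> * d (4 * N) s + R * real N powr \<gamma>) integrable_on {0..t}"
        by (intro integrable_continuous_real continuous_intros cont)
      fix s assume "s \<in> {0..t}"
      then show "e N s \<le> \<epsilon> * d (4 * N) s + R * real N powr \<gamma>"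
        using interp[OF N, of s] lower[OF N, of s] by auto
    qed
    also have "\<dots> = \<epsilon> * I (4 * N) + t * R * real N powr \<gamma>"
      unfolding I_def using t
      by (subst integral_add)
        (auto intro!: integrable_continuous_real continuous_intros cont)
    finally show ?thesis .
  qed
  \<comment> \<open>A finite number attained at a scale \<open>M\<close>. Evaluating the estimate at
    this very scale allows terms in \<open>m\<close> to be absorbed, although they came from the
    scale \<open>4 * N\<close>.\<close>
  define m where "m = Max ((\<lambda>N. I N / real N powr \<gamma>) ` {1..2 * K})"
  have fin: "finite ((\<lambda>N. I N / real N powr \<gamma>) ` {1..2 * K})"
    "(\<lambda>N. I N / real N powr \<gamma>) ` {1..2 * K} \<noteq> {}" using K by auto
  obtain M where M: "M \<in> {1..2 * K}" "m = I M / real M powr \<gamma>"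
    using Max_in[OF fin] unfolding m_def by auto
  have m0: "0 \<le> m" unfolding M(2) using I0 by simp
  have I: "I N \<le> 64 * m * real N powr \<gamma>" if "1 \<le> N" for N
  proof (rule scaled_family_bound[OF \<gamma> K m0 _ _ that])
    fix N assume N: "1 \<le> N" "N \<le> 2 * K"
    then have "I N / real N powr \<gamma> \<le> m" unfolding m_def using fin by (intro Max_ge) auto
    then show "I N \<le> m * real N powr \<gamma>" using N by (simp add: field_simps)
  next
    fix N assume N: "2 * K \<le> N"
    have "I N \<le> integral {0..t} (\<lambda>s. (real N / real K) ^ 4 * d (2 * K) s)"
      unfolding I_def using big(2)[OF N] cont
      by (intro integral_le integrable_continuous_real continuous_intros) auto
    then show "I N \<le> (real N / real K) ^ 4 * I (2 * K)" unfolding I_def by simp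
  qed
  have I4: "I (4 * N) \<le> 262144 * m * real N powr \<gamma>" if "1 \<le> N" for N
  proof -
    have "I (4 * N) \<le> 64 * m * real (4 * N) powr \<gamma>" using that by (intro I) auto
    also have "\<dots> \<le> 64 * m * (4096 * real N powr \<gamma>)" using m0 four by (intro mult_left_mono) auto
    finally show ?thesis by simp
  qed
  have CE: "\<kappa> * C * integral {0..t} (e N) \<le> (\<kappa> * m * (c / 4) + B / 4) * real N powr \<gamma>"
    if N: "1 \<le> N" for N
  proof -
    have "\<kappa> * C * integral {0..t} (e N) \<le> \<kappa> * C * (\<epsilon> * (262144 * m * real N powr \<gamma>) + t * R * real N powr \<gamma>)"
    proof (rule mult_left_mono)
      have "\<epsilon> * I (4 * N) \<le> \<epsilon> * (262144 * m * real N powr \<gamma>)"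
        using I4[OF N] \<epsilon> by (intro mult_left_mono) auto
      then show "integral {0..t} (e N) \<le> \<epsilon> * (262144 * m * real N powr \<gamma>) + t * R * real N powr \<gamma>"
        using E[OF N] by linarith
    qed (use \<kappa> C in auto)
    also have "\<dots> = (\<kappa> * m * (262144 * (C * \<epsilon>)) + \<kappa> * t * (C * C' * (524288 * B) powr p)) * real N powr \<gamma>"
      by (simp add: R_def algebra_simps)
    also have "\<dots> \<le> (\<kappa> * m * (c / 4) + B / 4) * real N powr \<gamma>"
      using \<epsilon> time \<kappa> m0 by (intro mult_right_mono add_mono mult_left_mono) auto
    finally show ?thesis .
  qed
  have en: "A N t + \<kappa> * c * I N \<le> (\<kappa> * m * (c / 4) + 5 / 4 * B) * real N powr \<gamma>" if N: "1 \<le> N" for N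
    using energy[OF N] CE[OF N] init[OF N] by (simp add: I_def algebra_simps)
  \<comment> \<open>At \<open>M\<close> the estimate reads
    \<open>\<kappa> * c * m \<le> \<kappa> * c * m / 4 + 5 / 4 * B\<close>. Inserting the result
    into \<open>en\<close> gives the coefficient \<open>5/12 + 5/4 = 5/3\<close>, strictly below
    \<open>2\<close>; inserting it into \<open>CE\<close> gives \<open>5/12 + 1/4\<close>, below
    \<open>1\<close>.\<close>
  have km: "\<kappa> * c * m \<le> 5 / 3 * B"
  proof -
    have M1: "1 \<le> M" using M by simp
    define P where "P = real M powr \<gamma>"
    have P: "0 < P" using M1 by (simp add: P_def)
    have "I M = m * P" using P unfolding M(2) P_def by simp
    moreover have "\<kappa> * c * I M \<le> (\<kappa> * m * (c / 4) + 5 / 4 * B) * P"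
      using en[OF M1] nonneg(1)[of t M] t unfolding P_def by linarith
    ultimately have "(\<kappa> * c * m) * P \<le> (\<kappa> * m * (c / 4) + 5 / 4 * B) * P"
      by (simp add: mult_ac)
    then have "\<kappa> * c * m \<le> \<kappa> * m * (c / 4) + 5 / 4 * B" using P by simp
    then show ?thesis by (simp add: field_simps)
  qed
  {
    fix N :: nat assume N: "1 \<le> N"
    have "0 \<le> \<kappa> * c * I N" using \<kappa> c I0 by simp
    then have "A N t \<le> (\<kappa> * m * (c / 4) + 5 / 4 * B) * real N powr \<gamma>" using en[OF N] by linarith
    also have "\<dots> < (2 * B) * real N powr \<gamma>"
      using km B N by (intro mult_strict_right_mono) (auto simp: field_simps)
    finally show "A N t < 2 * B * real N powr \<gamma>" .
  }
  have e1: "\<kappa> * C * integral {0..t} (e 1) \<le> B"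
    using CE[of 1] km B by (simp add: field_simps)
  show "\<kappa> * integral {0..t} (e 1) \<le> B"
  proof (cases "0 \<le> integral {0..t} (e 1)")
    case True
    have "\<kappa> * 1 * integral {0..t} (e 1) \<le> \<kappa> * C * integral {0..t} (e 1)"
      using C \<kappa> True by (intro mult_right_mono mult_left_mono) auto
    then show ?thesis using e1 by simp
  next
    case False
    then have "\<kappa> * integral {0..t} (e 1) \<le> 0" using \<kappa> by (simp add: mult_le_0_iff)
    then show ?thesis using B by linarith
  qed
qed

lemma bootstrap:
  fixes A d e :: "nat \<Rightarrow> real \<Rightarrow> real" and K :: nat and \<alpha> \<kappa> c C \<epsilon> C' B T :: real
  defines "\<gamma> \<equiv> 5 + 4 / 5 * \<alpha>" and "p \<equiv> (5 + \<alpha>) / \<alpha>"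
  assumes \<alpha>: "0 < \<alpha>" "\<alpha> < 1" and K: "1 \<le> K" and \<kappa>: "0 < \<kappa>" and c: "0 < c" and C: "1 \<le> C"
    and \<epsilon>: "0 < \<epsilon>" "262144 * (C * \<epsilon>) \<le> c / 4" and C': "0 \<le> C'" and B: "0 < B" and T: "0 \<le> T"
    and cont: "\<And>N. continuous_on {0..T} (A N)" "\<And>N. continuous_on {0..T} (d N)"
      "\<And>N. continuous_on {0..T} (e N)"
    and nonneg: "\<And>N s. 0 \<le> s \<Longrightarrow> s \<le> T \<Longrightarrow> 0 \<le> A N s" "\<And>N s. 0 \<le> s \<Longrightarrow> s \<le> T \<Longrightarrow> 0 \<le> d N s"
    and energy: "\<And>N t. 1 \<le> N \<Longrightarrow> 0 \<le> t \<Longrightarrow> t \<le> T \<Longrightarrow>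
      A N t + \<kappa> * (c * integral {0..t} (d N) - C * integral {0..t} (e N)) \<le> A N 0"
    and interp: "\<And>N s. 1 \<le> N \<Longrightarrow> 0 \<le> s \<Longrightarrow> s \<le> T \<Longrightarrow>
      e N s \<le> \<epsilon> * d (4 * N) s + C' * real N * (A (4 * N) s / real N ^ 5) powr p"
    and init: "\<And>N. 1 \<le> N \<Longrightarrow> A N 0 \<le> B * real N powr \<gamma>"
    and big: "\<And>N s. 2 * K \<le> N \<Longrightarrow> 0 \<le> s \<Longrightarrow> s \<le> T \<Longrightarrow>
        A N s \<le> (real N / real K) ^ 4 * A (2 * K) s"
      "\<And>N s. 2 * K \<le> N \<Longrightarrow> 0 \<le> s \<Longrightarrow> s \<le> T \<Longrightarrow>
        d N s \<le> (real N / real K) ^ 4 * d (2 * K) s"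
    and time: "\<kappa> * T * (C * C' * (524288 * B) powr p) \<le> B / 4"
  shows "\<kappa> * integral {0..T} (e 1) \<le> B"
proof -
  have step: "(\<forall>N\<ge>1. A N t < 2 * B * real N powr \<gamma>) \<and> \<kappa> * integral {0..t} (e 1) \<le> B"
    if t: "0 \<le> t" "t \<le> T" and
      bound: "\<And>N s. 1 \<le> N \<Longrightarrow> N \<le> 2 * K \<Longrightarrow> 0 \<le> s \<Longrightarrow> s \<le> t \<Longrightarrow> A N s \<le> 2 * B * real N powr \<gamma>"
    for t
  proof -
    have sub: "continuous_on {0..t} f" if "continuous_on {0..T} f" for f :: "real \<Rightarrow> real"
      using that by (rule continuous_on_subset) (use t in auto)
    have tm: "\<kappa> * t * (C * C' * (524288 * B) powr ((5 + \<alpha>) / \<alpha>)) \<le> B / 4"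
    proof -
      have "\<kappa> * t * (C * C' * (524288 * B) powr p) \<le> \<kappa> * T * (C * C' * (524288 * B) powr p)"
        using t \<kappa> C C' by (intro mult_right_mono mult_left_mono) auto
      then show ?thesis using time unfolding p_def by linarith
    qed
    have c1: "continuous_on {0..t} (d N)" for N by (rule sub[OF cont(2)])
    have c2: "continuous_on {0..t} (e N)" for N by (rule sub[OF cont(3)])
    have n1: "0 \<le> A N s" if "0 \<le> s" "s \<le> t" for N s using nonneg(1) that t by simp
    have n2: "0 \<le> d N s" if "0 \<le> s" "s \<le> t" for N s using nonneg(2) that t by simp
    have en: "A N t + \<kappa> * (c * integral {0..t} (d N) - C * integral {0..t} (e N)) \<le> A N 0"
      if "1 \<le> N" for N using energy[OF that t] .
    have int: "e N s \<le> \<epsilon> * d (4 * N) s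
        + C' * real N * (A (4 * N) s / real N ^ 5) powr ((5 + \<alpha>) / \<alpha>)"
      if "1 \<le> N" "0 \<le> s" "s \<le> t" for N s
      using interp[of N s] that t by (simp add: p_def)
    have b1: "A N s \<le> (real N / real K) ^ 4 * A (2 * K) s"
      if "2 * K \<le> N" "0 \<le> s" "s \<le> t" for N s using big(1) that t by simp
    have b2: "d N s \<le> (real N / real K) ^ 4 * d (2 * K) s"
      if "2 * K \<le> N" "0 \<le> s" "s \<le> t" for N s using big(2) that t by simp
    have "A N t < 2 * B * real N powr \<gamma>" if "1 \<le> N" for N
      unfolding \<gamma>_def
      by (rule bootstrap_step(1)[where A = A and d = d and e = e and t = t,
            OF \<alpha> K \<kappa> c C \<epsilon> C' B t(1)],
          fact c1, fact c2, fact n1, fact n2, fact en, fact int, fact init[unfolded \<gamma>_def],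
          fact b1, fact b2, fact tm, fact bound[unfolded \<gamma>_def], fact that)
    moreover have "\<kappa> * integral {0..t} (e 1) \<le> B"
      by (rule bootstrap_step(2)[where A = A and d = d and e = e and t = t,
            OF \<alpha> K \<kappa> c C \<epsilon> C' B t(1)],
          fact c1, fact c2, fact n1, fact n2, fact en, fact int, fact init[unfolded \<gamma>_def],
          fact b1, fact b2, fact tm, fact bound[unfolded \<gamma>_def])
    ultimately show ?thesis by blast
  qed
  \<comment> \<open>The times at which the bound is reached or exceeded at some scale. Only finitely
    many scales are involved, so the set is closed and has a first element unless it is empty; there
    \<open>step\<close> yields the strict inequality, a contradiction.\<close>
  define S where "S = (\<Union>N\<in>{1..2 * K}. {t \<in> {0..T}. 2 * B * real N powr \<gamma> \<le> A N t})"
  have "closed {t \<in> {0..T}. 2 * B * real N powr \<gamma> \<le> A N t}" for N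
  proof -
    have "{t \<in> {0..T}. 2 * B * real N powr \<gamma> \<le> A N t} = {0..T} \<inter> A N -` {2 * B * real N powr \<gamma>..}"
      by auto
    then show ?thesis using continuous_closed_preimage[OF cont(1)] by simp
  qed
  then have "closed S" unfolding S_def by (intro closed_UN ballI) auto
  have S: "S = {}"
  proof (rule ccontr)
    assume "S \<noteq> {}"
    moreover have "compact S"
    proof -
      have "S = {0..T} \<inter> S" by (auto simp: S_def)
      then show ?thesis using compact_Int_closed[OF compact_Icc \<open>closed S\<close>] by metis
    qed
    ultimately obtain t where t: "t \<in> S" "\<forall>s\<in>S. t \<le> s" using compact_attains_inf by blast
    then have tT: "0 \<le> t" "t \<le> T" by (auto simp: S_def)
    have before: "A N s < 2 * B * real N powr \<gamma>" if "1 \<le> N" "N \<le> 2 * K" "0 \<le> s" "s < t" for N s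
    proof (rule ccontr)
      assume "\<not> ?thesis"
      then have "s \<in> S"
        unfolding S_def using that tT by (intro UN_I[of N]) (auto simp: not_less)
      then show False using t that by auto
    qed
    have le: "A N s \<le> 2 * B * real N powr \<gamma>" if N: "1 \<le> N" "N \<le> 2 * K" and s: "0 \<le> s" "s \<le> t" for N s
    \<comment> \<open>For \<open>t = 0\<close> the interval \<open>{0..<t}\<close> is empty and the
      limit argument says nothing; the initial bound replaces it.\<close>
    proof (cases "t = 0")
      case True
      have "B * real N powr \<gamma> \<le> 2 * B * real N powr \<gamma>" using B by simp
      then show ?thesis using init[OF N(1)] True s by simp
    next
      case False
      then have cl: "closure {0..<t} = {0..t}" using tT by simp
      show ?thesis
      proof (rule continuous_le_on_closure[of "{0..<t}" "A N" s])
        show "continuous_on (closure {0..<t}) (A N)"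
          unfolding cl by (rule continuous_on_subset[OF cont(1)]) (use tT in auto)
        show "s \<in> closure {0..<t}" unfolding cl using s by simp
        fix r assume "r \<in> {0..<t}"
        then show "A N r \<le> 2 * B * real N powr \<gamma>" using before[OF N, of r] by simp
      qed
    qed
    have "\<forall>N\<ge>1. A N t < 2 * B * real N powr \<gamma>" using step[OF tT le] by blast
    then show False using t(1) unfolding S_def by fastforce
  qed
  have "A N s \<le> 2 * B * real N powr \<gamma>" if "1 \<le> N" "N \<le> 2 * K" "0 \<le> s" "s \<le> T" for N s
  proof (rule ccontr)
    assume "\<not> ?thesis"
    then have "s \<in> S" unfolding S_def using that by (intro UN_I[of N]) (auto simp: not_le)
    then show False using S by simp
  qed
  then show ?thesis using step[of T] T by blast
qed

subsection \<open>The discretized thin film equation\<close>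

lemma thin_film_velocity_eq_flux:
  assumes "1 \<le> K"
  shows "thin_film_velocity K x k
    = real K ^ 3 * (flux (density K x) (int k) - flux (density K x) (int k - 1))"
proof -
  define z where "z = density K x"
  have K: "real K \<noteq> 0" using assms by simp
  have eq: "1 / 2 * z j ^ 3 * laplace_op (1 / real K) z j
      + 1 / 4 * z j ^ 2 * laplace_op (1 / real K) (\<lambda>i. z i ^ 2) j = (real K)\<^sup>2 * flux z j" for j
    unfolding laplace_op_def flux_def using K
    by (simp add: field_simps power2_eq_square power3_eq_cube)
  show ?thesis
    unfolding thin_film_velocity_def Let_def diff_op_def z_def[symmetric] eq
    by (simp add: algebra_simps power2_eq_square power3_eq_cube)
qed

context
  fixes K :: nat and x :: "real \<Rightarrow> nat \<Rightarrow> real"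
  assumes K: "1 \<le> K" and sol: "thin_film_solution K x"
begin

lemma density_zero: "j \<notin> {0..<int K} \<Longrightarrow> density K (x t) j = 0"
  by (auto simp: density_def)

lemma density_pos: "0 \<le> t \<Longrightarrow> j \<in> {0..<int K} \<Longrightarrow> 0 < density K (x t) j"
proof -
  assume t: "0 \<le> t" and j: "j \<in> {0..<int K}"
  then have "x t (nat j) < x t (Suc (nat j))" using sol by (auto simp: thin_film_solution_def)
  moreover have "nat (j + 1) = Suc (nat j)" using j by auto
  ultimately show ?thesis using j K by (auto simp: density_def)
qed

lemma density_nonneg: "0 \<le> t \<Longrightarrow> 0 \<le> density K (x t) j"
  using density_pos density_zero by (cases "j \<in> {0..<int K}") force+

text \<open>The width of a cell changes at \<open>K ^ 3\<close> times the second difference of the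
  flux; differentiating the reciprocal \<open>(1 / K) / d\<close> contributes
  \<open>- K * z^2\<close>.\<close>

lemma density_has_derivative:
  assumes t: "0 \<le> t" and j: "j \<in> {0..<int K}"
  shows "((\<lambda>s. density K (x s) j) has_real_derivative
    - (real K ^ 4 * (density K (x t) j)\<^sup>2 * (flux (density K (x t)) (j + 1)
        - 2 * flux (density K (x t)) j + flux (density K (x t)) (j - 1)))) (at t within {0..})"
proof -
  define k where "k = nat j"
  have k: "j = int k" "k < K" "nat (int k + 1) = Suc k" using j by (auto simp: k_def)
  define F where "F = flux (density K (x t))"
  define d where "d = x t (Suc k) - x t k"
  have d: "0 < d" using sol t k by (simp add: thin_film_solution_def d_def)
  have der: "((\<lambda>s. x s i) has_real_derivative real K ^ 3 * (F (int i) - F (int i - 1))) (at t within {0..})"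
    if "i \<le> K" for i
  proof -
    have "((\<lambda>s. x s i) has_real_derivative thin_film_velocity K (x t) i) (at t within {0..})"
      using sol t that unfolding thin_film_solution_def by blast
    then show ?thesis unfolding thin_film_velocity_eq_flux[OF K] F_def .
  qed
  have eq: "(\<lambda>s. density K (x s) j) = (\<lambda>s. (1 / real K) / (x s (Suc k) - x s k))"
    using k by (auto simp: density_def)
  have z: "density K (x t) j = (1 / real K) / d" using fun_cong[OF eq, of t] by (simp add: d_def)
  have "((\<lambda>s. (1 / real K) / (x s (Suc k) - x s k)) has_real_derivative
      (0 * (x t (Suc k) - x t k) - (1 / real K) *
        (real K ^ 3 * (F (int (Suc k)) - F (int (Suc k) - 1)) - real K ^ 3 * (F (int k) - F (int k - 1))))
      / ((x t (Suc k) - x t k) * (x t (Suc k) - x t k))) (at t within {0..})"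
    using k d by (intro DERIV_divide DERIV_const DERIV_diff der) (auto simp: d_def)
  also have "(0 * (x t (Suc k) - x t k) - (1 / real K) *
        (real K ^ 3 * (F (int (Suc k)) - F (int (Suc k) - 1)) - real K ^ 3 * (F (int k) - F (int k - 1))))
      / ((x t (Suc k) - x t k) * (x t (Suc k) - x t k))
    = - (real K ^ 4 * (density K (x t) j)\<^sup>2 * (F (j + 1) - 2 * F j + F (j - 1)))"
    unfolding z d_def[symmetric] using d K k
    by (simp add: field_simps power2_eq_square power3_eq_cube power4_eq_xxxx add.commute)
  finally show ?thesis unfolding eq F_def .
qed

lemma continuous_on_density: "continuous_on {0..} (\<lambda>s. density K (x s) j)"
proof (cases "j \<in> {0..<int K}")
  case True
  then show ?thesis
    unfolding continuous_on_eq_continuous_within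
    by (auto intro!: DERIV_continuous density_has_derivative)
qed (simp add: density_zero)

lemma weighted_power_has_derivative:
  assumes t: "0 \<le> t" and \<alpha>: "0 < \<alpha>"
  shows "((\<lambda>s. \<Sum>j\<in>{-1..int K}. \<phi> j * density K (x s) j powr \<alpha>) has_real_derivative
    - (\<alpha> * real K ^ 4 * (\<Sum>j\<in>{-1..int K}. \<phi> j * density K (x t) j powr (1 + \<alpha>)
        * (flux (density K (x t)) (j + 1) - 2 * flux (density K (x t)) j + flux (density K (x t)) (j - 1)))))
    (at t within {0..})"
proof -
  define D where "D j = flux (density K (x t)) (j + 1) - 2 * flux (density K (x t)) j
    + flux (density K (x t)) (j - 1)" for j
  have "((\<lambda>s. \<phi> j * density K (x s) j powr \<alpha>) has_real_derivative
     \<phi> j * - (\<alpha> * real K ^ 4 * density K (x t) j powr (1 + \<alpha>) * D j)) (at t within {0..})" for j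
  proof (cases "j \<in> {0..<int K}")
    case True
    define z where "z = density K (x t) j"
    have z: "0 < z" using density_pos[OF t True] by (simp add: z_def)
    have "((\<lambda>s. density K (x s) j powr \<alpha>) has_real_derivative
      (\<alpha> * z powr (\<alpha> - 1)) * - (real K ^ 4 * z\<^sup>2 * D j)) (at t within {0..})"
      unfolding z_def D_def
      by (intro DERIV_chain2[OF has_real_derivative_powr density_has_derivative[OF t True]])
        (rule density_pos[OF t True])
    also have "(\<alpha> * z powr (\<alpha> - 1)) * - (real K ^ 4 * z\<^sup>2 * D j)
        = - (\<alpha> * real K ^ 4 * z powr (1 + \<alpha>) * D j)"
      using z powr_add[of z "\<alpha> - 1" 2] by simp
    finally show ?thesis unfolding z_def by (rule DERIV_cmult)
  next
    case False
    then show ?thesis by (simp add: density_zero)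
  qed
  then have "((\<lambda>s. \<Sum>j\<in>{-1..int K}. \<phi> j * density K (x s) j powr \<alpha>) has_real_derivative
    (\<Sum>j\<in>{-1..int K}. \<phi> j * - (\<alpha> * real K ^ 4 * density K (x t) j powr (1 + \<alpha>) * D j)))
    (at t within {0..})"
    by (intro DERIV_sum)
  also have "(\<Sum>j\<in>{-1..int K}. \<phi> j * - (\<alpha> * real K ^ 4 * density K (x t) j powr (1 + \<alpha>) * D j))
    = - (\<alpha> * real K ^ 4 * (\<Sum>j\<in>{-1..int K}. \<phi> j * density K (x t) j powr (1 + \<alpha>) * D j))"
    by (simp add: sum_distrib_left sum_negf mult_ac)
  finally show ?thesis unfolding D_def .
qed

lemma continuous_on_density_powr:
  "0 < \<beta> \<Longrightarrow> continuous_on {0..} (\<lambda>s. density K (x s) j powr \<beta>)"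
  using density_nonneg by (intro continuous_on_powr' continuous_on_density continuous_intros) auto

lemma continuous_on_dissipation:
  "0 < \<alpha> \<Longrightarrow> continuous_on {0..} (\<lambda>s. dissipation \<alpha> (density K (x s)) j)"
  unfolding dissipation_def
  by (intro continuous_intros continuous_on_density_powr continuous_on_density) auto

lemma continuous_on_flux: "continuous_on {0..} (\<lambda>s. flux (density K (x s)) j)"
  unfolding flux_def by (intro continuous_intros continuous_on_density) auto

lemma integrated_energy_dissipation:
  assumes \<alpha>: "0 < \<alpha>" and t: "0 \<le> t"
    and ineq: "\<And>s. 0 \<le> s \<Longrightarrow> c * (\<Sum>j\<in>{-1..int K}. \<phi> j * dissipation \<alpha> (density K (x s)) j)
        - C * (\<Sum>j\<in>{0..int N + 1}. density K (x s) j powr (5 + \<alpha>))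
      \<le> (\<Sum>j\<in>{-1..int K}. \<phi> j * density K (x s) j powr (1 + \<alpha>)
            * (flux (density K (x s)) (j + 1) - 2 * flux (density K (x s)) j + flux (density K (x s)) (j - 1)))"
  shows "(\<Sum>j\<in>{-1..int K}. \<phi> j * density K (x t) j powr \<alpha>)
      + \<alpha> * real K ^ 4 * (c * integral {0..t} (\<lambda>s. \<Sum>j\<in>{-1..int K}. \<phi> j * dissipation \<alpha> (density K (x s)) j)
        - C * integral {0..t} (\<lambda>s. \<Sum>j\<in>{0..int N + 1}. density K (x s) j powr (5 + \<alpha>)))
    \<le> (\<Sum>j\<in>{-1..int K}. \<phi> j * density K (x 0) j powr \<alpha>)"
proof -
  define A where "A s = (\<Sum>j\<in>{-1..int K}. \<phi> j * density K (x s) j powr \<alpha>)" for s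
  define d where "d s = (\<Sum>j\<in>{-1..int K}. \<phi> j * dissipation \<alpha> (density K (x s)) j)" for s
  define e where "e s = (\<Sum>j\<in>{0..int N + 1}. density K (x s) j powr (5 + \<alpha>))" for s
  define G where "G s = (\<Sum>j\<in>{-1..int K}. \<phi> j * density K (x s) j powr (1 + \<alpha>)
      * (flux (density K (x s)) (j + 1) - 2 * flux (density K (x s)) j + flux (density K (x s)) (j - 1)))" for s
  have sub: "continuous_on {0..t} f" if "continuous_on {0..} f" for f :: "real \<Rightarrow> real"
    using that by (rule continuous_on_subset) auto
  have cd: "continuous_on {0..t} d" unfolding d_def
    by (intro sub continuous_intros continuous_on_dissipation \<alpha>)
  have ce: "continuous_on {0..t} e" unfolding e_def using \<alpha>
    by (intro sub continuous_intros continuous_on_density_powr) auto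
  have "((\<lambda>s. - (\<alpha> * real K ^ 4 * G s)) has_integral A t - A 0) {0..t}"
  proof (rule fundamental_theorem_of_calculus[OF t])
    fix s assume "s \<in> {0..t}"
    then have "(A has_real_derivative - (\<alpha> * real K ^ 4 * G s)) (at s within {0..})"
      unfolding A_def G_def using \<alpha> by (intro weighted_power_has_derivative) auto
    then have "(A has_real_derivative - (\<alpha> * real K ^ 4 * G s)) (at s within {0..t})"
      by (rule DERIV_subset) auto
    then show "(A has_vector_derivative - (\<alpha> * real K ^ 4 * G s)) (at s within {0..t})"
      by (simp add: has_real_derivative_iff_has_vector_derivative)
  qed
  moreover have "((\<lambda>s. - (\<alpha> * real K ^ 4 * (c * d s - C * e s))) has_integral
      - (\<alpha> * real K ^ 4 * (c * integral {0..t} d - C * integral {0..t} e))) {0..t}"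
    by (intro has_integral_neg has_integral_mult_right has_integral_diff integrable_integral
        integrable_continuous_real cd ce)
  ultimately have "A t - A 0 \<le> - (\<alpha> * real K ^ 4 * (c * integral {0..t} d - C * integral {0..t} e))"
  proof (rule has_integral_le)
    fix s assume "s \<in> {0..t}"
    then have "c * d s - C * e s \<le> G s" unfolding d_def e_def G_def using ineq[of s] by simp
    then show "- (\<alpha> * real K ^ 4 * G s) \<le> - (\<alpha> * real K ^ 4 * (c * d s - C * e s))"
      using \<alpha> by (simp add: mult_left_mono)
  qed
  then show ?thesis unfolding A_def d_def e_def by linarith
qed

text \<open>With no density to the left of cell \<open>0\<close>, the velocity of the end point is
  \<open>K ^ 3\<close> times the flux in that cell, a quartic form in the first two densities
  only.\<close>

lemma left_end_displacement:
  assumes t: "0 \<le> t"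
  shows "\<bar>x t 0 - x 0 0\<bar> \<le> 5 * real K ^ 3
    * integral {0..t} (\<lambda>s. density K (x s) 0 ^ 4 + density K (x s) 1 ^ 4)"
proof -
  define f where "f s = 5 * real K ^ 3 * (density K (x s) 0 ^ 4 + density K (x s) 1 ^ 4)" for s
  have vel: "\<bar>real K ^ 3 * flux (density K (x s)) 0\<bar> \<le> f s" if s: "0 \<le> s" for s
  proof -
    define y p where "y = density K (x s) 0" and "p = density K (x s) 1"
    have yp: "0 \<le> y" "0 \<le> p" using density_nonneg[OF s] by (auto simp: y_def p_def)
    have fl: "flux (density K (x s)) 0 = y\<^sup>2 / 4 * (p\<^sup>2 + 2 * (y * p) - 6 * y\<^sup>2)"
      using density_zero[of "-1" s]
      by (simp add: flux_def y_def p_def power2_eq_square algebra_simps)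
    have "2 * (y * p) \<le> y\<^sup>2 + p\<^sup>2" using sum_squares_bound[of y p] by simp
    moreover have "0 \<le> y * p" using yp by simp
    ultimately have "\<bar>p\<^sup>2 + 2 * (y * p) - 6 * y\<^sup>2\<bar> \<le> 2 * p\<^sup>2 + 6 * y\<^sup>2"
      using zero_le_power2[of y] zero_le_power2[of p] by linarith
    then have "\<bar>flux (density K (x s)) 0\<bar> \<le> y\<^sup>2 / 4 * (2 * p\<^sup>2 + 6 * y\<^sup>2)"
      unfolding fl abs_mult by (intro mult_mono) auto
    also have "\<dots> \<le> 5 * (y ^ 4 + p ^ 4)"
    proof -
      have "2 * (y\<^sup>2 * p\<^sup>2) \<le> y ^ 4 + p ^ 4" 
        using sum_squares_bound[of "y\<^sup>2" "p\<^sup>2"] by simp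
      moreover have "0 \<le> y ^ 4" "0 \<le> p ^ 4" by auto
      moreover have "y\<^sup>2 / 4 * (2 * p\<^sup>2 + 6 * y\<^sup>2) = (y\<^sup>2 * p\<^sup>2) / 2 + 3 / 2 * y ^ 4"
        by (simp add: algebra_simps power2_eq_square power4_eq_xxxx)
      ultimately show ?thesis unfolding distrib_left by linarith
    qed
    finally have "real K ^ 3 * \<bar>flux (density K (x s)) 0\<bar> \<le> real K ^ 3 * (5 * (y ^ 4 + p ^ 4))"
      by (intro mult_left_mono) auto
    also have "\<dots> = f s" by (simp add: f_def y_def p_def)
    finally show ?thesis by (simp add: abs_mult)
  qed
  have "((\<lambda>s. real K ^ 3 * flux (density K (x s)) 0) has_integral x t 0 - x 0 0) {0..t}"
  proof (rule fundamental_theorem_of_calculus[OF t])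
    fix s assume s: "s \<in> {0..t}"
    have "flux (density K (x s)) (- 1) = 0" using density_zero[of "-1" s] by (simp add: flux_def)
    then have "thin_film_velocity K (x s) 0 = real K ^ 3 * flux (density K (x s)) 0"
      using thin_film_velocity_eq_flux[OF K, of "x s" 0] by simp
    moreover have "((\<lambda>s. x s 0) has_real_derivative thin_film_velocity K (x s) 0) (at s within {0..})"
      using sol s unfolding thin_film_solution_def by auto
    ultimately have "((\<lambda>s. x s 0) has_real_derivative real K ^ 3 * flux (density K (x s)) 0) (at s within {0..})"
      by simp
    then have "((\<lambda>s. x s 0) has_real_derivative real K ^ 3 * flux (density K (x s)) 0) (at s within {0..t})"
      by (rule DERIV_subset) auto
    then show "((\<lambda>s. x s 0) has_vector_derivative real K ^ 3 * flux (density K (x s)) 0) (at s within {0..t})"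
      by (simp add: has_real_derivative_iff_has_vector_derivative)
  qed
  then have "x t 0 - x 0 0 = integral {0..t} (\<lambda>s. real K ^ 3 * flux (density K (x s)) 0)"
    by (rule integral_unique[symmetric])
  moreover have "norm (integral {0..t} (\<lambda>s. real K ^ 3 * flux (density K (x s)) 0)) \<le> integral {0..t} f"
  proof (rule integral_norm_bound_integral)
    have c: "continuous_on {0..} (\<lambda>s. real K ^ 3 * flux (density K (x s)) 0)" "continuous_on {0..} f"
      unfolding f_def by (intro continuous_intros continuous_on_flux continuous_on_density)+
    show "(\<lambda>s. real K ^ 3 * flux (density K (x s)) 0) integrable_on {0..t}" "f integrable_on {0..t}"
      by (auto intro!: integrable_continuous_real continuous_on_subset[OF c(1)] continuous_on_subset[OF c(2)])
  qed (use vel in auto)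
  moreover have "integral {0..t} f = 5 * real K ^ 3
    * integral {0..t} (\<lambda>s. density K (x s) 0 ^ 4 + density K (x s) 1 ^ 4)"
    unfolding f_def by (rule integral_mult_right)
  ultimately show ?thesis by simp
qed

end

subsection \<open>Initial data\<close>

lemma sum_cutoff_upper_bound:
  fixes g :: "int \<Rightarrow> real"
  assumes K: "1 \<le> K" and g: "\<And>j. 0 \<le> g j" "\<And>j. j \<notin> {0..<int K} \<Longrightarrow> g j = 0"
  shows "(\<Sum>j\<in>{-1..int K}. cutoff N j * g j)
    \<le> (real N / real K) ^ 4 * (\<Sum>j\<in>{-1..int K}. cutoff (2 * K) j * g j)"
proof -
  have "cutoff N j * g j \<le> (real N / real K) ^ 4 * (cutoff (2 * K) j * g j)" for j
  proof (cases "j \<in> {0..<int K}")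
    case True
    have "cutoff N j \<le> real N ^ 4"
      unfolding cutoff_def using True by (intro power_mono) auto
    also have "\<dots> = (real N / real K) ^ 4 * real K ^ 4" using K by (simp add: power_divide)
    also have "\<dots> \<le> (real N / real K) ^ 4 * cutoff (2 * K) j"
    proof (rule mult_left_mono)
      have "real K \<le> max 0 (real_of_int (int (2 * K) - j))" using True by (auto simp: max_def)
      then show "real K ^ 4 \<le> cutoff (2 * K) j" unfolding cutoff_def by (rule power_mono) simp
    qed simp
    finally have "cutoff N j * g j \<le> (real N / real K) ^ 4 * cutoff (2 * K) j * g j"
      using g(1) by (rule mult_right_mono)
    then show ?thesis by (simp add: mult.assoc)
  next
    case False
    then show ?thesis using g(2) by simp
  qed
  then show ?thesis unfolding sum_distrib_left by (rule sum_mono)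
qed

text \<open>Jensen's inequality through the tangent at the mean value, whose linear part integrates
  to zero. For a cell of mass \<open>1 / K\<close> the mean value is the discrete density.\<close>

lemma cell_jensen:
  fixes u :: "real \<Rightarrow> real" and \<alpha> l r m :: real
  assumes u: "continuous_on {l..r} u" "\<And>y. 0 \<le> u y" and \<alpha>: "0 < \<alpha>" and lr: "l < r"
    and m: "integral {l..r} u = m" "0 < m"
  shows "m * (m / (r - l)) powr \<alpha> \<le> integral {l..r} (\<lambda>y. u y powr (1 + \<alpha>))"
proof -
  define z where "z = m / (r - l)"
  have z: "0 < z" "z * (r - l) = m" using lr m by (auto simp: z_def)
  have tangent: "z powr (1 + \<alpha>) + (1 + \<alpha>) * z powr \<alpha> * (u y - z) \<le> u y powr (1 + \<alpha>)" for y
  proof -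
    have "z powr (1 + \<alpha>) * (1 + (1 + \<alpha>) * (u y / z - 1)) \<le> z powr (1 + \<alpha>) * (u y / z) powr (1 + \<alpha>)"
      using u(2) z \<alpha> by (intro mult_left_mono powr_ge_bernoulli) auto
    also have "z powr (1 + \<alpha>) * (u y / z) powr (1 + \<alpha>) = u y powr (1 + \<alpha>)"
      using z by (simp flip: powr_mult)
    also have "z powr (1 + \<alpha>) * (1 + (1 + \<alpha>) * (u y / z - 1))
        = z powr (1 + \<alpha>) + (1 + \<alpha>) * z powr \<alpha> * (u y - z)"
      using z by (simp add: powr_add field_simps)
    finally show ?thesis .
  qed
  have iu: "(u has_integral m) {l..r}"
    using integrable_integral[OF integrable_continuous_real[OF u(1)]] m by simp
  have const: "((\<lambda>_. c) has_integral (r - l) * c) {l..r}" for c :: real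
    using has_integral_const_real[of c l r] lr by simp
  have "((\<lambda>y. z powr (1 + \<alpha>) + (1 + \<alpha>) * z powr \<alpha> * (u y - z)) has_integral
      (r - l) * z powr (1 + \<alpha>) + (1 + \<alpha>) * z powr \<alpha> * (m - (r - l) * z)) {l..r}"
    by (intro has_integral_add has_integral_mult_right has_integral_diff iu const)
  moreover have "((\<lambda>y. u y powr (1 + \<alpha>)) has_integral integral {l..r} (\<lambda>y. u y powr (1 + \<alpha>))) {l..r}"
    using u \<alpha> by (intro integrable_integral integrable_continuous_real continuous_on_powr'
        continuous_intros) auto
  ultimately have "(r - l) * z powr (1 + \<alpha>) + (1 + \<alpha>) * z powr \<alpha> * (m - (r - l) * z)
      \<le> integral {l..r} (\<lambda>y. u y powr (1 + \<alpha>))"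
    by (rule has_integral_le) (rule tangent)
  moreover have "(r - l) * z powr (1 + \<alpha>) + (1 + \<alpha>) * z powr \<alpha> * (m - (r - l) * z) = m * z powr \<alpha>"
    using z by (simp add: powr_add mult_ac)
  ultimately show ?thesis by (simp add: z_def)
qed

context
  fixes u :: "real \<Rightarrow> real" and xbar :: "nat \<Rightarrow> real" and K :: nat and \<alpha> bbar :: real
  assumes \<alpha>: "0 < \<alpha>" and u: "continuous_on UNIV u" "\<And>y. 0 \<le> u y" and K: "2 \<le> K"
    and incr: "\<And>k. k < K \<Longrightarrow> xbar k < xbar (Suc k)"
    and mass: "\<And>k. k \<le> K \<Longrightarrow> integral {xbar 0..xbar k} u = real k / real K"
    and bdd: "bdd_above (edge_ratio \<alpha> u (xbar 0) ` {xbar 0<..<xbar K})"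
    and bbar: "bbar = (SUP l\<in>{xbar 0<..<xbar K}. edge_ratio \<alpha> u (xbar 0) l)"
begin

lemma mesh_mono: "i \<le> k \<Longrightarrow> k \<le> K \<Longrightarrow> xbar i \<le> xbar k"
proof (induction k rule: dec_induct)
  case (step n)
  then show ?case using incr[of n] by simp
qed simp

lemma mesh_strict_mono: "i < k \<Longrightarrow> k \<le> K \<Longrightarrow> xbar i < xbar k"
  using mesh_mono[of "Suc i" k] incr[of i] by simp

lemma integrable_u: "u integrable_on {l..r}"
  by (intro integrable_continuous_real continuous_on_subset[OF u(1)]) auto

lemma continuous_u_powr: "continuous_on S (\<lambda>y. u y powr (1 + \<alpha>))"
  using u \<alpha> by (intro continuous_on_powr' continuous_intros continuous_on_subset[OF u(1)]) auto

lemma integrable_u_powr: "(\<lambda>y. u y powr (1 + \<alpha>)) integrable_on {l..r}"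
  by (intro integrable_continuous_real continuous_u_powr)

lemma cell_mass: "k < K \<Longrightarrow> integral {xbar k..xbar (Suc k)} u = 1 / real K"
  using Henstock_Kurzweil_Integration.integral_combine[of "xbar 0" "xbar k" "xbar (Suc k)" u]
    mesh_mono[of 0 k] incr[of k] mass[of k] mass[of "Suc k"] integrable_u
  by (simp add: add_divide_distrib)

lemma density_power_sum_le:
  "N \<le> K \<Longrightarrow> (\<Sum>k<N. 1 / real K * density K xbar (int k) powr \<alpha>)
    \<le> integral {xbar 0..xbar N} (\<lambda>y. u y powr (1 + \<alpha>))"
proof (induction N)
  case (Suc N)
  have "1 / real K * (1 / real K / (xbar (Suc N) - xbar N)) powr \<alpha>
      \<le> integral {xbar N..xbar (Suc N)} (\<lambda>y. u y powr (1 + \<alpha>))"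
    using Suc.prems incr[of N] cell_mass[of N] K
    by (intro cell_jensen u(2) \<alpha> continuous_on_subset[OF u(1)]) auto
  moreover have "density K xbar (int N) = 1 / real K / (xbar (Suc N) - xbar N)"
  proof -
    have "nat (int N + 1) = Suc N" by simp
    then show ?thesis using Suc.prems by (simp add: density_def)
  qed
  moreover have "integral {xbar 0..xbar N} (\<lambda>y. u y powr (1 + \<alpha>))
      + integral {xbar N..xbar (Suc N)} (\<lambda>y. u y powr (1 + \<alpha>))
    = integral {xbar 0..xbar (Suc N)} (\<lambda>y. u y powr (1 + \<alpha>))"
    using Suc.prems mesh_mono[of 0 N] incr[of N] integrable_u_powr
    by (intro Henstock_Kurzweil_Integration.integral_combine) auto
  ultimately show ?case using Suc by simp
qed simp

text \<open>Positive mass excludes the default value \<open>0\<close> of a division by zero, for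
  which a bound on the ratio would say nothing about its numerator.\<close>

lemma integral_u_powr_le_of_mass_pos:
  assumes l: "xbar 0 < l" "l < xbar K" and pos: "0 < integral {xbar 0..l} u"
  shows "integral {xbar 0..l} (\<lambda>y. u y powr (1 + \<alpha>)) \<le> bbar * integral {xbar 0..l} u powr (1 + 4 / 5 * \<alpha>)"
proof -
  have "edge_ratio \<alpha> u (xbar 0) l \<le> bbar"
    unfolding bbar using l bdd by (intro cSUP_upper) auto
  then show ?thesis using pos by (simp add: edge_ratio_def pos_divide_le_eq)
qed

lemma bbar_pos: "0 < bbar"
proof -
  have x1: "xbar 0 < xbar 1" "xbar 1 < xbar K" using mesh_strict_mono K by auto
  have m1: "integral {xbar 0..xbar 1} u = 1 / real K" using mass[of 1] K by simp
  have "0 < 1 / real K * (1 / real K / (xbar 1 - xbar 0)) powr \<alpha>" using x1 K by simp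
  also have "\<dots> \<le> integral {xbar 0..xbar 1} (\<lambda>y. u y powr (1 + \<alpha>))"
    using x1 K m1 by (intro cell_jensen u(2) \<alpha> continuous_on_subset[OF u(1)]) auto
  also have "\<dots> \<le> bbar * integral {xbar 0..xbar 1} u powr (1 + 4 / 5 * \<alpha>)"
    using x1 m1 K by (intro integral_u_powr_le_of_mass_pos) auto
  finally have "0 < bbar * integral {xbar 0..xbar 1} u powr (1 + 4 / 5 * \<alpha>)" .
  then show ?thesis using zero_less_mult_pos2 m1 K by fastforce
qed

lemma integral_u_powr_le:
  assumes N: "1 \<le> N" "N \<le> K"
  shows "integral {xbar 0..xbar N} (\<lambda>y. u y powr (1 + \<alpha>)) \<le> bbar * (real N / real K) powr (1 + 4 / 5 * \<alpha>)"
proof (cases "N < K")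
  case True
  have "integral {xbar 0..xbar N} (\<lambda>y. u y powr (1 + \<alpha>))
      \<le> bbar * integral {xbar 0..xbar N} u powr (1 + 4 / 5 * \<alpha>)"
    using True N mass[of N] mesh_strict_mono[of 0 N] mesh_strict_mono[of N K]
    by (intro integral_u_powr_le_of_mass_pos) auto
  then show ?thesis using mass[of N] N by simp
next
  case False
  then have NK: "N = K" using N by simp
  \<comment> \<open>The supremum runs over the open interval, so the right end point is reached as a
    limit. Starting at the last interior node keeps the mass positive, as
    \<open>2 \<le> K\<close>.\<close>
  define F where "F l = integral {xbar 0..l} (\<lambda>y. u y powr (1 + \<alpha>))" for l
  define c where "c = xbar (K - 1)"
  have c: "xbar 0 < c" "c < xbar K" using mesh_strict_mono K by (auto simp: c_def)
  then have cl: "closure {c..<xbar K} = {c..xbar K}" by simp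
  have "F (xbar K) \<le> bbar"
  proof (rule continuous_le_on_closure[of "{c..<xbar K}" F "xbar K" bbar])
    have "continuous_on {xbar 0..xbar K} F"
      unfolding F_def by (intro indefinite_integral_continuous_1 integrable_u_powr)
    then show "continuous_on (closure {c..<xbar K}) F"
      unfolding cl by (rule continuous_on_subset) (use c in auto)
    show "xbar K \<in> closure {c..<xbar K}" unfolding cl using c by simp
    fix l assume l: "l \<in> {c..<xbar K}"
    have "integral {xbar 0..c} u \<le> integral {xbar 0..l} u"
      using l c u(2) by (intro integral_subset_le integrable_u) auto
    moreover have "0 < integral {xbar 0..c} u" using mass[of "K - 1"] K by (simp add: c_def)
    ultimately have pos: "0 < integral {xbar 0..l} u" by linarith
    have le1: "integral {xbar 0..l} u \<le> 1"
    proof -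
      have "integral {xbar 0..l} u \<le> integral {xbar 0..xbar K} u"
        using l c u(2) by (intro integral_subset_le integrable_u) auto
      then show ?thesis using mass[of K] K by simp
    qed
    have "F l \<le> bbar * integral {xbar 0..l} u powr (1 + 4 / 5 * \<alpha>)"
      unfolding F_def using l c pos by (intro integral_u_powr_le_of_mass_pos) auto
    also have "\<dots> \<le> bbar * 1"
      using bbar_pos le1 pos \<alpha> by (intro mult_left_mono powr_le1) auto
    finally show "F l \<le> bbar" by simp
  qed
  then show ?thesis using NK K by (simp add: F_def)
qed

text \<open>The cutoff is at most \<open>N ^ 4\<close>, and Jensen turns the remaining sum into
  \<open>K\<close> times the integral that \<open>bbar\<close> controls at mass
  \<open>min N K / K\<close>.\<close>

lemma initial_weighted_power_bound:
  assumes N: "1 \<le> N"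
  shows "(\<Sum>j\<in>{-1..int K}. cutoff N j * density K xbar j powr \<alpha>)
    \<le> bbar * real K powr (- (4 / 5 * \<alpha>)) * real N powr (5 + 4 / 5 * \<alpha>)"
proof -
  define n where "n = min N K"
  have n: "1 \<le> n" "n \<le> K" "n \<le> N" using N K by (auto simp: n_def)
  have K0: "0 < real K" and N0: "0 < real N" using K N by auto
  have "(\<Sum>j\<in>{-1..int K}. cutoff N j * density K xbar j powr \<alpha>)
      = (\<Sum>j\<in>{0..<int n}. cutoff N j * density K xbar j powr \<alpha>)"
    using n by (intro sum.mono_neutral_right) (auto simp: density_def cutoff_def n_def)
  also have "\<dots> \<le> (\<Sum>j\<in>{0..<int n}. real N ^ 4 * density K xbar j powr \<alpha>)"
    by (intro sum_mono mult_right_mono) (auto simp: cutoff_def intro!: power_mono)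
  also have "\<dots> = real N ^ 4 * (\<Sum>k<n. density K xbar (int k) powr \<alpha>)"
    unfolding sum_distrib_left
    by (rule sum.reindex_bij_witness[of _ int nat]) auto
  also have "\<dots> = real N ^ 4 * (real K * (\<Sum>k<n. 1 / real K * density K xbar (int k) powr \<alpha>))"
    using K0 by (simp flip: sum_divide_distrib)
  also have "\<dots> \<le> real N ^ 4 * (real K * (bbar * (real N / real K) powr (1 + 4 / 5 * \<alpha>)))"
  proof (intro mult_left_mono)
    have "(\<Sum>k<n. 1 / real K * density K xbar (int k) powr \<alpha>)
        \<le> bbar * (real n / real K) powr (1 + 4 / 5 * \<alpha>)"
      using density_power_sum_le[OF n(2)] integral_u_powr_le[OF n(1,2)] by linarith
    also have "\<dots> \<le> bbar * (real N / real K) powr (1 + 4 / 5 * \<alpha>)"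
      using bbar_pos n \<alpha> by (intro mult_left_mono powr_mono2 divide_right_mono) auto
    finally show "(\<Sum>k<n. 1 / real K * density K xbar (int k) powr \<alpha>)
        \<le> bbar * (real N / real K) powr (1 + 4 / 5 * \<alpha>)" .
  qed auto
  also have "\<dots> = bbar * real K powr (- (4 / 5 * \<alpha>)) * real N powr (5 + 4 / 5 * \<alpha>)"
  proof -
    have "real N powr (5 + 4 / 5 * \<alpha>) = real N ^ 4 * real N powr (1 + 4 / 5 * \<alpha>)"
      using powr_add[of "real N" 4 "1 + 4 / 5 * \<alpha>"] N0 by simp
    moreover have "(real N / real K) powr (1 + 4 / 5 * \<alpha>)
        = real N powr (1 + 4 / 5 * \<alpha>) * (real K powr (- (4 / 5 * \<alpha>)) / real K)"
    proof -
      have "real K powr (1 + 4 / 5 * \<alpha>) = real K * real K powr (4 / 5 * \<alpha>)"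
        using powr_add[of "real K" 1 "4 / 5 * \<alpha>"] K0 by simp
      then show ?thesis unfolding powr_divide powr_minus_divide by simp
    qed
    ultimately show ?thesis using K0 by simp
  qed
  finally show ?thesis .
qed

end

subsection \<open>Displacement of the left end point\<close>

text \<open>Hoelder's inequality in time, in the form of a pointwise split at the threshold \<mu>
  for \<open>f ^ 4\<close>.\<close>

lemma integral_power4_bound:
  fixes f :: "real \<Rightarrow> real" and \<alpha> R t :: real
  assumes \<alpha>: "0 < \<alpha>" and R: "0 < R" and t: "0 < t"
    and f: "continuous_on {0..t} f" "\<And>s. 0 \<le> s \<Longrightarrow> s \<le> t \<Longrightarrow> 0 \<le> f s"
    and int: "integral {0..t} (\<lambda>s. f s powr (5 + \<alpha>)) \<le> R"
  shows "integral {0..t} (\<lambda>s. f s ^ 4) \<le> 2 * (R powr (4 / (5 + \<alpha>)) * t powr ((1 + \<alpha>) / (5 + \<alpha>)))"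
proof -
  define q where "q = 4 / (5 + \<alpha>)"
  have q: "0 < q" "q < 1" "1 - q = (1 + \<alpha>) / (5 + \<alpha>)" "q * ((1 + \<alpha>) / 4) = 1 - q"
    using \<alpha> by (auto simp: q_def field_simps)
  \<comment> \<open>This value makes the contributions of both cases equal, whence the factor
    \<open>2\<close>.\<close>
  define \<mu> where "\<mu> = (R / t) powr q"
  have \<mu>: "0 < \<mu>" using R t by (simp add: \<mu>_def)
  have \<mu>1: "\<mu> = R powr q * t powr (- q)"
    by (simp add: \<mu>_def powr_divide powr_minus_divide)
  have \<mu>2: "\<mu> powr (- ((1 + \<alpha>) / 4)) = R powr (q - 1) * t powr (1 - q)"
  proof -
    have "\<mu> powr (- ((1 + \<alpha>) / 4)) = (R / t) powr (- (1 - q))"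
      unfolding \<mu>_def powr_powr by (simp only: mult_minus_right q(4))
    also have "\<dots> = R powr (q - 1) * t powr (1 - q)"
      using R t by (simp add: powr_divide powr_minus_divide[of t "1 - q", simplified])
    finally show ?thesis .
  qed
  have pt: "v ^ 4 \<le> \<mu> + \<mu> powr (- ((1 + \<alpha>) / 4)) * v powr (5 + \<alpha>)" if v: "0 \<le> v" for v :: real
  proof (cases "v ^ 4 \<le> \<mu>")
    case True
    moreover have "0 \<le> \<mu> powr (- ((1 + \<alpha>) / 4)) * v powr (5 + \<alpha>)" by simp
    ultimately show ?thesis by linarith
  next
    case False
    then have vp: "0 < v" using v \<mu> by (cases "v = 0") auto
    have "(v ^ 4) powr (- ((1 + \<alpha>) / 4)) \<le> \<mu> powr (- ((1 + \<alpha>) / 4))"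
      using \<mu> False \<alpha> by (intro powr_mono2') auto
    then have "(v ^ 4) powr (- ((1 + \<alpha>) / 4)) * v powr (5 + \<alpha>) \<le> \<mu> powr (- ((1 + \<alpha>) / 4)) * v powr (5 + \<alpha>)"
      by (intro mult_right_mono) auto
    moreover have "(v ^ 4) powr (- ((1 + \<alpha>) / 4)) * v powr (5 + \<alpha>) = v ^ 4"
    proof -
      have "(v ^ 4) powr (- ((1 + \<alpha>) / 4)) = v powr (- (1 + \<alpha>))"
      proof -
        have "(v powr 4) powr (- ((1 + \<alpha>) / 4)) = v powr (- (1 + \<alpha>))"
          unfolding powr_powr by (rule arg_cong[where f = "(powr) v"]) (simp add: field_simps)
        then show ?thesis using vp by simp
      qed
      then have "(v ^ 4) powr (- ((1 + \<alpha>) / 4)) * v powr (5 + \<alpha>) = v powr (- (1 + \<alpha>) + (5 + \<alpha>))"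
        by (simp only: powr_add)
      then show ?thesis using vp by simp
    qed
    ultimately show ?thesis using \<mu> by linarith
  qed
  have "integral {0..t} (\<lambda>s. f s ^ 4)
      \<le> integral {0..t} (\<lambda>s. \<mu> + \<mu> powr (- ((1 + \<alpha>) / 4)) * f s powr (5 + \<alpha>))"
    using f \<alpha> pt t
    by (intro integral_le integrable_continuous_real continuous_intros continuous_on_powr') auto
  also have "\<dots> = t * \<mu> + \<mu> powr (- ((1 + \<alpha>) / 4)) * integral {0..t} (\<lambda>s. f s powr (5 + \<alpha>))"
    using f \<alpha> t by (subst integral_add)
      (auto intro!: integrable_continuous_real continuous_intros continuous_on_powr')
  also have "\<dots> \<le> t * \<mu> + \<mu> powr (- ((1 + \<alpha>) / 4)) * R"
    using int t by (intro add_mono mult_left_mono) auto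
  also have "t * \<mu> = R powr q * t powr (1 - q)"
    unfolding \<mu>1 using t powr_add[of t 1 "- q"] by simp
  also have "\<mu> powr (- ((1 + \<alpha>) / 4)) * R = R powr q * t powr (1 - q)"
    unfolding \<mu>2 using R powr_add[of R "q - 1" 1] by simp
  finally have "integral {0..t} (\<lambda>s. f s ^ 4)
      \<le> 2 * (R powr q * t powr ((1 + \<alpha>) / (5 + \<alpha>)))" unfolding q(3) by simp
  then show ?thesis by (simp only: q_def)
qed

text \<open>The power \<open>1 / 5\<close> of the mesh width arises here:
  \<open>(4/5 * \<alpha> + 4) * 4 / (5 + \<alpha>) = 16/5\<close>, and
  \<open>3 - 16/5 = - 1/5\<close>.\<close>

lemma displacement_scaling:
  fixes K :: nat and \<alpha> b t :: real
  assumes K: "1 \<le> K" and \<alpha>: "0 < \<alpha>" and b: "0 < b" and t: "0 < t"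
  shows "real K ^ 3 * ((b * real K powr (- (4 / 5 * \<alpha>)) / (\<alpha> * real K ^ 4)) powr (4 / (5 + \<alpha>))
      * t powr ((1 + \<alpha>) / (5 + \<alpha>)))
    = \<alpha> powr (- (4 / (5 + \<alpha>))) * (1 / real K) powr (1 / 5) * (b ^ 4 * t powr (1 + \<alpha>)) powr (1 / (5 + \<alpha>))"
proof -
  define q where "q = 4 / (5 + \<alpha>)"
  have K0: "0 < real K" using K by simp
  have e: "(- (4 / 5 * \<alpha>) - 4) * q = - (16 / 5)" using \<alpha> by (simp add: q_def field_simps)
  have "b * real K powr (- (4 / 5 * \<alpha>)) / (\<alpha> * real K ^ 4) = b * (1 / \<alpha>) * real K powr (- (4 / 5 * \<alpha>) - 4)"
    using K0 powr_diff[of "real K" "- (4 / 5 * \<alpha>)" 4] by simp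
  then have 1: "(b * real K powr (- (4 / 5 * \<alpha>)) / (\<alpha> * real K ^ 4)) powr q
      = b powr q * (1 / \<alpha>) powr q * real K powr (- (16 / 5))"
    by (simp only: powr_mult powr_powr e)
  have 2: "real K ^ 3 * real K powr (- (16 / 5)) = (1 / real K) powr (1 / 5)"
  proof -
    have "real K ^ 3 * real K powr (- (16 / 5)) = real K powr (3 + - (16 / 5))"
      unfolding powr_add using K0 by simp
    also have "3 + - (16 / 5) = - (1 / 5 :: real)" by simp
    also have "real K powr - (1 / 5) = (1 / real K) powr (1 / 5)"
      by (simp add: powr_minus_divide powr_divide)
    finally show ?thesis .
  qed
  have 3: "(b ^ 4 * t powr (1 + \<alpha>)) powr (1 / (5 + \<alpha>)) = b powr q * t powr ((1 + \<alpha>) / (5 + \<alpha>))"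
  proof -
    have "b ^ 4 = b powr 4" using b by simp
    then show ?thesis by (simp only: powr_mult powr_powr q_def) simp
  qed
  have 4: "(1 / \<alpha>) powr q = \<alpha> powr (- q)" by (simp add: powr_minus_divide powr_divide)
  show ?thesis
    unfolding 3 q_def[symmetric] 1 2[symmetric] 4 by simp
qed

theorem theorem2:
  fixes \<alpha> :: real
  assumes "0 < \<alpha>" and "\<alpha> < 1 / 32"
  shows "\<exists>C>0. \<exists>M>0.
    \<forall>(u :: real \<Rightarrow> real) (a :: real) (b :: real) (K :: nat)
      (xbar :: nat \<Rightarrow> real) (x :: real \<Rightarrow> nat \<Rightarrow> real) (bbar :: real).
      continuous_on UNIV u \<longrightarrow>
      (\<forall>y. 0 \<le> u y) \<longrightarrow>
      closure {y. u y \<noteq> 0} = {a..b} \<longrightarrow>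
      (\<forall>y\<in>{a<..<b}. 0 < u y) \<longrightarrow>
      integral {a..b} u = 1 \<longrightarrow>
      2 \<le> K \<longrightarrow>
      xbar 0 = a \<longrightarrow> xbar K = b \<longrightarrow>
      (\<forall>k<K. xbar k < xbar (Suc k)) \<longrightarrow>
      (\<forall>k\<le>K. integral {xbar 0..xbar k} u = real k / real K) \<longrightarrow>
      thin_film_solution K x \<longrightarrow>
      (\<forall>k\<le>K. x 0 k = xbar k) \<longrightarrow>
      bdd_above (edge_ratio \<alpha> u (xbar 0) ` {a<..<b}) \<longrightarrow>
      bbar = (SUP l\<in>{a<..<b}. edge_ratio \<alpha> u (xbar 0) l) \<longrightarrow>
      (\<forall>t. 0 \<le> t \<longrightarrow> t \<le> C * bbar powr (- (5 / \<alpha>)) \<longrightarrow>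
        \<bar>x t 0 - xbar 0\<bar>
          \<le> M * (1 / real K) powr (1 / 5) * (bbar ^ 4 * t powr (1 + \<alpha>)) powr (1 / (5 + \<alpha>)))"
proof -
  note \<alpha> = assms
  have \<alpha>1: "\<alpha> < 1" using \<alpha> by simp
  define p where "p = (5 + \<alpha>) / \<alpha>"
  obtain C0 where C0: "0 \<le> C0" and energy:
    "\<And>(z :: int \<Rightarrow> real) K N. (\<And>j. 0 \<le> z j) \<Longrightarrow> (\<And>j. j \<notin> {0..<int K} \<Longrightarrow> z j = 0) \<Longrightarrow>
      1 / 200 * (\<Sum>j\<in>{-1..int K}. cutoff N j * dissipation \<alpha> z j)
        - C0 * (\<Sum>j\<in>{0..int N + 1}. z j powr (5 + \<alpha>))
      \<le> (\<Sum>j\<in>{-1..int K}. cutoff N j * z j powr (1 + \<alpha>)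
            * (flux z (j + 1) - 2 * flux z j + flux z (j - 1)))"
    using energy_dissipation[OF \<alpha>] by blast
  \<comment> \<open>Enlarged so that \<open>1 \<le> D\<close>, which lets \<open>bootstrap\<close>
    pass from \<open>D\<close> times the error integral to the error integral itself.\<close>
  define D where "D = C0 + 1"
  have D: "1 \<le> D" using C0 by (simp add: D_def)
  \<comment> \<open>\<open>209715200 = 262144 * 800\<close>: the loss between scales times the
    reciprocal of a quarter of \<open>1 / 200\<close>.\<close>
  define \<epsilon> where "\<epsilon> = 1 / (209715200 * D)"
  have \<epsilon>: "0 < \<epsilon>" "262144 * (D * \<epsilon>) \<le> 1 / 200 / 4"
    using D by (auto simp: \<epsilon>_def field_simps)
  obtain C' where C': "0 \<le> C'" and interp:
    "\<And>(z :: int \<Rightarrow> real) K N. (\<And>j. 0 \<le> z j) \<Longrightarrow> (\<And>j. j \<notin> {0..<int K} \<Longrightarrow> z j = 0) \<Longrightarrow> 1 \<le> N \<Longrightarrow>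
      (\<Sum>j\<in>{0..int N + 1}. z j powr (5 + \<alpha>))
      \<le> \<epsilon> * (\<Sum>j\<in>{-1..int K}. cutoff (4 * N) j * dissipation \<alpha> z j)
        + C' * real N * ((\<Sum>j\<in>{-1..int K}. cutoff (4 * N) j * z j powr \<alpha>) / real N ^ 5)
            powr ((5 + \<alpha>) / \<alpha>)"
    using interpolation[OF \<alpha>(1) \<alpha>1 \<epsilon>(1)] by blast
  \<comment> \<open>The reciprocal of the time constant, read off from the hypothesis
    \<open>time\<close> of \<open>bootstrap\<close>; \<open>C' + 1\<close> keeps it positive even if
    \<open>C' = 0\<close>.\<close>
  define W where "W = 4 * \<alpha> * D * (C' + 1) * 524288 powr p"
  have W: "0 < W" using \<alpha> D C' by (simp add: W_def)
  \<comment> \<open>\<open>20 = 5 * 2 * 2\<close>: the flux bound, two cells, and the factor of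
    \<open>integral_power4_bound\<close>.\<close>
  define M where "M = 20 * \<alpha> powr (- (4 / (5 + \<alpha>)))"
  have M: "0 < M" using \<alpha> by (simp add: M_def)
  have main: "\<bar>x t 0 - xbar 0\<bar>
      \<le> M * (1 / real K) powr (1 / 5) * (bbar ^ 4 * t powr (1 + \<alpha>)) powr (1 / (5 + \<alpha>))"
    if u: "continuous_on UNIV u" "\<And>y. 0 \<le> u y" and K: "2 \<le> K"
      and incr: "\<And>k. k < K \<Longrightarrow> xbar k < xbar (Suc k)"
      and mass: "\<And>k. k \<le> K \<Longrightarrow> integral {xbar 0..xbar k} u = real k / real K"
      and sol: "thin_film_solution K x" and start: "\<And>k. k \<le> K \<Longrightarrow> x 0 k = xbar k"
      and bdd: "bdd_above (edge_ratio \<alpha> u (xbar 0) ` {xbar 0<..<xbar K})"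
      and bbar: "bbar = (SUP l\<in>{xbar 0<..<xbar K}. edge_ratio \<alpha> u (xbar 0) l)"
      and t: "0 \<le> t" "t \<le> 1 / W * bbar powr (- (5 / \<alpha>))"
    for u :: "real \<Rightarrow> real" and K :: nat and xbar x bbar t
  proof (cases "t = 0")
    case True
    then show ?thesis using start[of 0] M by simp
  next
    case False
    with t have t0: "0 < t" by simp
    have K1: "1 \<le> K" and K0: "0 < real K" using K by auto
    define z where "z s = Defs.density K (x s)" for s
    note z0 = density_nonneg[OF K1 sol, folded z_def]
    note zz = density_zero[OF K1 sol, folded z_def]
    have bp: "0 < bbar" by (rule bbar_pos[OF \<alpha>(1) u K incr mass bdd bbar])
    define B where "B = bbar * real K powr (- (4 / 5 * \<alpha>))"
    have B: "0 < B" using bp K0 by (simp add: B_def)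
    define A where "A N s = (\<Sum>j\<in>{-1..int K}. cutoff N j * z s j powr \<alpha>)" for N s
    define d where "d N s = (\<Sum>j\<in>{-1..int K}. cutoff N j * dissipation \<alpha> (z s) j)" for N s
    define e where "e N s = (\<Sum>j\<in>{0..int N + 1}. z s j powr (5 + \<alpha>))" for N s
    define \<kappa> where "\<kappa> = \<alpha> * real K ^ 4"
    have \<kappa>: "0 < \<kappa>" using \<alpha> K0 by (simp add: \<kappa>_def)
    have sub: "continuous_on {0..t} f" if "continuous_on {0..} f" for f :: "real \<Rightarrow> real"
      using that by (rule continuous_on_subset) auto
    note cpow = continuous_on_density_powr[OF K1 sol, folded z_def]
    have cA: "continuous_on {0..t} (A N)" for N
      unfolding A_def using \<alpha> by (intro sub continuous_intros cpow)
    have cd: "continuous_on {0..t} (d N)" for N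
      unfolding d_def using \<alpha>
      by (intro sub continuous_intros continuous_on_dissipation[OF K1 sol, folded z_def])
    have ce: "continuous_on {0..t} (e N)" for N
      unfolding e_def using \<alpha> by (intro sub continuous_intros cpow) auto
    have en: "A N r + \<kappa> * (1 / 200 * integral {0..r} (d N) - D * integral {0..r} (e N)) \<le> A N 0"
      if "1 \<le> N" "0 \<le> r" "r \<le> t" for N r
      unfolding A_def d_def e_def \<kappa>_def z_def
    proof (rule integrated_energy_dissipation[OF K1 sol \<alpha>(1) that(2)])
      fix s :: real assume s: "0 \<le> s"
      have "0 \<le> e N s" unfolding e_def by (intro sum_nonneg) auto
      then have "D * e N s = C0 * e N s + e N s" "0 \<le> e N s" by (simp_all add: D_def algebra_simps)
      moreover have "1 / 200 * d N s - C0 * e N s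
        \<le> (\<Sum>j\<in>{-1..int K}. cutoff N j * z s j powr (1 + \<alpha>)
            * (flux (z s) (j + 1) - 2 * flux (z s) j + flux (z s) (j - 1)))"
        unfolding d_def e_def by (rule energy[OF z0[OF s] zz])
      ultimately have "1 / 200 * d N s - D * e N s
        \<le> (\<Sum>j\<in>{-1..int K}. cutoff N j * z s j powr (1 + \<alpha>)
            * (flux (z s) (j + 1) - 2 * flux (z s) j + flux (z s) (j - 1)))" by linarith
      then show "1 / 200 * (\<Sum>j\<in>{-1..int K}. cutoff N j * dissipation \<alpha> (Defs.density K (x s)) j)
        - D * (\<Sum>j\<in>{0..int N + 1}. Defs.density K (x s) j powr (5 + \<alpha>))
      \<le> (\<Sum>j\<in>{-1..int K}. cutoff N j * Defs.density K (x s) j powr (1 + \<alpha>)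
            * (flux (Defs.density K (x s)) (j + 1) - 2 * flux (Defs.density K (x s)) j
              + flux (Defs.density K (x s)) (j - 1)))"
        unfolding d_def e_def z_def .
    qed
    have "Defs.density K (x 0) = Defs.density K xbar"
      using start by (auto simp: density_def fun_eq_iff)
    then have init: "A N 0 \<le> B * real N powr (5 + 4 / 5 * \<alpha>)" if "1 \<le> N" for N
      using initial_weighted_power_bound[OF \<alpha>(1) u K incr mass bdd bbar that]
      by (simp add: A_def z_def B_def)
    have time: "\<kappa> * t * (D * C' * (524288 * B) powr ((5 + \<alpha>) / \<alpha>)) \<le> B / 4"
    proof -
      \<comment> \<open>One factor \<open>B\<close> is split off; the remaining
        \<open>B powr (5 / \<alpha>)\<close> contains \<open>1 / K ^ 4\<close>, which cancels the
        \<open>K ^ 4\<close> in \<kappa>.\<close>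
      have p1: "p = 1 + 5 / \<alpha>" using \<alpha> by (simp add: p_def field_simps)
      have B2: "B powr p = B * (bbar powr (5 / \<alpha>) / real K ^ 4)"
      proof -
        have "B powr (5 / \<alpha>) = bbar powr (5 / \<alpha>) * real K powr (- (4 / 5 * \<alpha>) * (5 / \<alpha>))"
          by (simp only: B_def powr_mult powr_powr)
        also have "- (4 / 5 * \<alpha>) * (5 / \<alpha>) = - 4" using \<alpha> by simp
        also have "real K powr - 4 = 1 / real K ^ 4" using K0 by (simp add: powr_minus_divide)
        finally show ?thesis using B by (simp add: p1 powr_add)
      qed
      have tb: "W * (t * bbar powr (5 / \<alpha>)) \<le> 1"
      proof -
        have "t * bbar powr (5 / \<alpha>) \<le> 1 / W * bbar powr (- (5 / \<alpha>)) * bbar powr (5 / \<alpha>)"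
          using t by (intro mult_right_mono) auto
        also have "\<dots> = 1 / W" using bp by (simp add: powr_minus_divide)
        finally show ?thesis using W by (simp add: field_simps)
      qed
      have "\<kappa> * t * (D * C' * (524288 * B) powr p)
          = \<alpha> * t * D * C' * 524288 powr p * B * bbar powr (5 / \<alpha>)"
        unfolding powr_mult B2 \<kappa>_def using K0 by simp
      also have "\<dots> \<le> \<alpha> * t * D * (C' + 1) * 524288 powr p * B * bbar powr (5 / \<alpha>)"
        using \<alpha> t D B by (intro mult_right_mono mult_left_mono) auto
      also have "\<dots> = W * (t * bbar powr (5 / \<alpha>)) * (B / 4)" by (simp add: W_def)
      also have "\<dots> \<le> 1 * (B / 4)" using tb B by (intro mult_right_mono) auto
      finally show ?thesis by (simp add: p_def)
    qed
    have nA: "0 \<le> A N s" if "0 \<le> s" "s \<le> t" for N s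
      unfolding A_def by (intro sum_nonneg) auto
    have nd: "0 \<le> d N s" if "0 \<le> s" "s \<le> t" for N s
      unfolding d_def by (intro sum_nonneg) auto
    have int: "e N s \<le> \<epsilon> * d (4 * N) s
        + C' * real N * (A (4 * N) s / real N ^ 5) powr ((5 + \<alpha>) / \<alpha>)"
      if "1 \<le> N" "0 \<le> s" "s \<le> t" for N s
      unfolding A_def d_def e_def by (rule interp[OF z0 zz]) (use that in auto)
    have b1: "A N s \<le> (real N / real K) ^ 4 * A (2 * K) s"
      if "2 * K \<le> N" "0 \<le> s" "s \<le> t" for N s
      unfolding A_def using zz by (intro sum_cutoff_upper_bound K1) auto
    have b2: "d N s \<le> (real N / real K) ^ 4 * d (2 * K) s"
      if "2 * K \<le> N" "0 \<le> s" "s \<le> t" for N s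
      unfolding d_def using zz by (intro sum_cutoff_upper_bound K1) (auto simp: dissipation_def)
    have "\<kappa> * integral {0..t} (e 1) \<le> B"
      by (rule bootstrap[where A = A and d = d and e = e and T = t,
            OF \<alpha>(1) \<alpha>1 K1 \<kappa> _ D \<epsilon> C' B t(1)], simp,
          fact cA, fact cd, fact ce, fact nA, fact nd, fact en, fact int, fact init, fact b1, fact b2,
          fact time)
    then have e1: "integral {0..t} (e 1) \<le> B / \<kappa>" using \<kappa> by (simp add: field_simps)
    have cz: "continuous_on {0..t} (\<lambda>s. z s j)" for j
      unfolding z_def by (intro sub continuous_on_density[OF K1 sol])
    have cz5: "continuous_on {0..t} (\<lambda>s. z s j powr (5 + \<alpha>))" for j
      using \<alpha> by (intro sub cpow) auto
    have zj: "integral {0..t} (\<lambda>s. z s j ^ 4)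
        \<le> 2 * ((B / \<kappa>) powr (4 / (5 + \<alpha>)) * t powr ((1 + \<alpha>) / (5 + \<alpha>)))" if j: "j \<in> {0, 1}" for j
    proof (rule integral_power4_bound[OF \<alpha>(1) _ t0 cz])
      have "integral {0..t} (\<lambda>s. z s j powr (5 + \<alpha>)) \<le> integral {0..t} (e 1)"
      proof (intro integral_le integrable_continuous_real cz5 ce)
        fix s
        show "z s j powr (5 + \<alpha>) \<le> e 1 s"
          unfolding e_def using j by (intro member_le_sum) auto
      qed
      then show "integral {0..t} (\<lambda>s. z s j powr (5 + \<alpha>)) \<le> B / \<kappa>" using e1 by linarith
    qed (use B \<kappa> z0 in auto)
    have "\<bar>x t 0 - xbar 0\<bar> \<le> 5 * real K ^ 3 * integral {0..t} (\<lambda>s. z s 0 ^ 4 + z s 1 ^ 4)"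
      using left_end_displacement[OF K1 sol t(1)] start[of 0] by (simp add: z_def)
    also have "integral {0..t} (\<lambda>s. z s 0 ^ 4 + z s 1 ^ 4)
        = integral {0..t} (\<lambda>s. z s 0 ^ 4) + integral {0..t} (\<lambda>s. z s 1 ^ 4)"
      by (intro integral_add integrable_continuous_real continuous_intros cz)
    also have "5 * real K ^ 3 * (integral {0..t} (\<lambda>s. z s 0 ^ 4) + integral {0..t} (\<lambda>s. z s 1 ^ 4))
        \<le> 5 * real K ^ 3 * (4 * ((B / \<kappa>) powr (4 / (5 + \<alpha>)) * t powr ((1 + \<alpha>) / (5 + \<alpha>))))"
      using zj[of 0] zj[of 1] by (intro mult_left_mono) auto
    also have "\<dots> = 20 * (real K ^ 3 * ((B / \<kappa>) powr (4 / (5 + \<alpha>)) * t powr ((1 + \<alpha>) / (5 + \<alpha>))))"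
      by simp
    also have "\<dots> = M * (1 / real K) powr (1 / 5) * (bbar ^ 4 * t powr (1 + \<alpha>)) powr (1 / (5 + \<alpha>))"
      unfolding B_def \<kappa>_def displacement_scaling[OF K1 \<alpha>(1) bp t0] M_def by simp
    finally show ?thesis .
  qed
  show ?thesis
  proof (rule exI[of _ "1 / W"], rule conjI, simp add: W, rule exI[of _ M], rule conjI, rule M,
      intro allI impI)
    fix u :: "real \<Rightarrow> real" and a b :: real and K :: nat and xbar x bbar t
    assume "continuous_on UNIV u" "\<forall>y. 0 \<le> u y" "2 \<le> K" "xbar 0 = a" "xbar K = b"
      "\<forall>k<K. xbar k < xbar (Suc k)" "\<forall>k\<le>K. integral {xbar 0..xbar k} u = real k / real K"
      "thin_film_solution K x" "\<forall>k\<le>K. x 0 k = xbar k"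
      "bdd_above (edge_ratio \<alpha> u (xbar 0) ` {a<..<b})"
      "bbar = (SUP l\<in>{a<..<b}. edge_ratio \<alpha> u (xbar 0) l)"
      "0 \<le> t" "t \<le> 1 / W * bbar powr (- (5 / \<alpha>))"
    then show "\<bar>x t 0 - xbar 0\<bar>
      \<le> M * (1 / real K) powr (1 / 5) * (bbar ^ 4 * t powr (1 + \<alpha>)) powr (1 / (5 + \<alpha>))"
      by (intro main[of u K xbar x bbar t]) auto
  qed
qed

end
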